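(* For any $k_0\in(0,\frac12)$ there exists $\alpha_2>0$ such that, for any $\gamma\in(0,k_0)$, $$\alpha_2\le M_2(G)\le\frac12\qquad\text{for all } G\in\mathscr{E}_\gamma .$$
   Context: $M_s(f)=\int_{\mathbb{R}}f(x)|x|^s\,dx$. For $k\in\mathbb{R}$ let $w_k(x)=(1+|x|)^k$, $x\in\mathbb{R}$, and let $L^1(w_k)$ be the space of measurable $f:\mathbb{R}\to\mathbb{R}$ with $\|f\|_{L^1(w_k)}=\int_{\mathbb{R}}|f(x)|w_k(x)\,dx<\infty$. For $\gamma\in[0,1]$, $\mathcal{Q}_\gamma$ is defined in weak form by $$\int_{\mathbb{R}}\mathcal{Q}_\gamma(f,g)(x)\varphi(x)\,dx=\frac12\int_{\mathbb{R}^2}f(x)g(y)\Big[2\varphi\big(\tfrac{x+y}{2}\big)-\varphi(x)-\varphi(y)\Big]|x-y|^\gamma\,dx\,dy .$$ For $\gamma\in[0,1)$, $\mathscr{E}_\gamma$ is the set of nonnegative functions $G\in\bigcap_{s<3}L^1(w_s)$ with $\int_{\mathbb{R}}G\,dx=1$, $\int_{\mathbb{R}}xG(x)\,dx=0$, which solve $\frac14\partial_x(xG)=\mathcal{Q}_\gamma(G,G)$, that is, $$-\frac14\int_{\mathbb{R}}x\varphi'(x)G(x)\,dx=\int_{\mathbb{R}}\mathcal{Q}_\gamma(G,G)(x)\varphi(x)\,dx\quad\text{for all }\varphi\in\mathcal{C}^1_b(\mathbb{R})$$ ($C^1$ functions bounded together with their derivative). *)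

theory Defs
  imports "HOL-Analysis.Analysis"
begin

definition moment :: "real \<Rightarrow> (real \<Rightarrow> real) \<Rightarrow> real" where
  "moment s f = (\<integral>x. f x * \<bar>x\<bar> powr s \<partial>lebesgue)"

definition weight :: "real \<Rightarrow> real \<Rightarrow> real" where
  "weight k x = (1 + \<bar>x\<bar>) powr k"

definition L1_weighted :: "real \<Rightarrow> (real \<Rightarrow> real) set" where
  "L1_weighted k =
     {f. f \<in> borel_measurable lebesgue \<and> integrable lebesgue (\<lambda>x. \<bar>f x\<bar> * weight k x)}"

text \<open>
  The collision operator is only given in weak form; \<open>collision_weak \<gamma> f g \<phi>\<close> is the pairing
  \<open>\<integral> Q\<^sub>\<gamma>(f, g)(x) \<phi>(x) dx\<close>. The convention \<open>0 powr 0 = 0\<close> has no effect for \<open>\<gamma> = 0\<close>,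
  because the bracket vanishes on the diagonal \<open>x = y\<close>.
\<close>
definition collision_weak ::
  "real \<Rightarrow> (real \<Rightarrow> real) \<Rightarrow> (real \<Rightarrow> real) \<Rightarrow> (real \<Rightarrow> real) \<Rightarrow> real" where
  "collision_weak \<gamma> f g \<phi> =
     1 / 2 * (\<integral>(x, y). f x * g y * (2 * \<phi> ((x + y) / 2) - \<phi> x - \<phi> y) * \<bar>x - y\<bar> powr \<gamma>
                \<partial>(lebesgue :: (real \<times> real) measure))"

definition C1_bounded :: "(real \<Rightarrow> real) set" where
  "C1_bounded =
     {\<phi>. (\<forall>x. \<phi> differentiable (at x)) \<and> continuous_on UNIV (deriv \<phi>) \<and>
         bounded (range \<phi>) \<and> bounded (range (deriv \<phi>))}"

text \<open>
  Elements of the weighted spaces are classes of functions modulo equality almost everywhere,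
  so nonnegativity is required almost everywhere. For \<open>\<gamma> < 1\<close> all Bochner integrals below are
  integrals of integrable functions, since \<open>G\<close> lies in \<open>L1_weighted s\<close> for every \<open>s < 3\<close>.
\<close>
definition steady_states :: "real \<Rightarrow> (real \<Rightarrow> real) set" where
  "steady_states \<gamma> =
     {G. G \<in> (\<Inter>s\<in>{..<3}. L1_weighted s) \<and>
         (AE x in lebesgue. 0 \<le> G x) \<and>
         (\<integral>x. G x \<partial>lebesgue) = 1 \<and>
         (\<integral>x. x * G x \<partial>lebesgue) = 0 \<and>
         (\<forall>\<phi>\<in>C1_bounded.
            - (1 / 4) * (\<integral>x. x * deriv \<phi> x * G x \<partial>lebesgue) = collision_weak \<gamma> G G \<phi>)}"

end

theory Submission
  imports Defs "HOL-Probability.Probability_Measure"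
begin

text \<open>
  Let \<open>X\<close>, \<open>Y\<close> be independent with density \<open>G\<close>, and let \<open>A s\<close> and \<open>m s\<close> be the absolute moments of
  order \<open>s\<close> of \<open>X - Y\<close> and of \<open>X\<close>. Testing the equation with \<open>x\<^sup>2\<close> gives \<open>A (2 + \<gamma>) = A 2 = 2 * m 2\<close>.
  Since \<open>t powr (2 + \<gamma>) - t\<^sup>2 \<ge> \<gamma> / 2 * (t\<^sup>2 - 1)\<close>, this forces \<open>A 2 \<le> 1\<close>, which is the upper bound.

  For the lower bound put \<open>k = 5 / 2\<close> and \<open>S = m 2 powr (k / 2)\<close>. Similar pointwise inequalities turn
  \<open>A (2 + \<gamma>) = A 2\<close> into \<open>A 2 \<le> A k \<le> A (k + \<gamma>)\<close>. Mixed moments are \<open>O(S)\<close>, so the second of these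
  gives \<open>m k \<le> m (k + \<gamma>) + O(S)\<close>, while testing with \<open>\<bar>x\<bar> powr k\<close> gives
  \<open>k / 4 * m k \<ge> (1 - 2 powr (1 - k)) * m (k + \<gamma>) - O(S)\<close>. Because \<open>1 - 2 powr (1 - k) > k / 4\<close> for
  \<open>2 < k < 3\<close>, both moments are \<open>O(S)\<close> uniformly in \<open>\<gamma>\<close>. Hence \<open>2 * m 2 \<le> A k = O(m 2 powr (5 / 4))\<close>.
\<close>

subsection \<open>Inequalities for real powers\<close>

text \<open>Bernoulli's inequality: a convex power lies above its tangent at 1. The point
  \<open>u = 0\<close> is treated separately because convexity is used on the open
  half-line.\<close>

lemma powr_ge_tangent:
  fixes u a :: real
  assumes "0 \<le> u" "1 \<le> a"
  shows "1 + a * (u - 1) \<le> u powr a"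
proof (cases "u = 0")
  case False
  then have u: "u \<in> {0<..}" using assms by auto
  have "a * 1 powr (a - 1) * (u - 1) \<le> u powr a - 1 powr a"
  proof (rule convex_on_imp_above_tangent[OF powr_convex[OF assms(2)] _ _ u])
    show "1 \<in> interior {0::real<..}" by (simp add: interior_open)
    show "((\<lambda>x. x powr a) has_real_derivative a * 1 powr (a - 1)) (at 1 within {0<..})"
      by (rule has_field_derivative_at_within, rule has_real_derivative_powr) simp
  qed (auto intro: convex_connected)
  then show ?thesis by simp
qed (use assms in auto)

text \<open>The convex version with exponent \<open>1 / a\<close>, applied to
  \<open>u powr a\<close>.\<close>

lemma powr_le_tangent:
  fixes u a :: real
  assumes "0 \<le> u" "0 < a" "a \<le> 1"
  shows "u powr a \<le> 1 + a * (u - 1)"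
proof -
  have "1 + 1 / a * (u powr a - 1) \<le> (u powr a) powr (1 / a)"
    by (rule powr_ge_tangent) (use assms in auto)
  also have "\<dots> = u" using assms by (simp add: powr_powr)
  finally show ?thesis using assms by (simp add: field_simps)
qed

text \<open>After division by \<open>a + b\<close> the two shares lie between 0 and 1, where an
  exponent at most 1 can only enlarge them, and they add up to 1.\<close>

lemma powr_subadditive:
  fixes a b r :: real
  assumes "0 \<le> a" "0 \<le> b" "0 \<le> r" "r \<le> 1"
  shows "(a + b) powr r \<le> a powr r + b powr r"
proof (cases "a + b = 0")
  case False
  then have pos: "0 < a + b" using assms by auto
  have *: "t / (a + b) * (a + b) powr r \<le> t powr r" if "0 \<le> t" "t \<le> a + b" for t
  proof -
    have "(t / (a + b)) powr 1 \<le> (t / (a + b)) powr r"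
      by (rule powr_mono') (use assms that pos in auto)
    then have "t / (a + b) \<le> t powr r / (a + b) powr r"
      using that pos by (simp add: powr_divide)
    then show ?thesis using pos by (simp add: pos_le_divide_eq)
  qed
  have "(a + b) powr r = a / (a + b) * (a + b) powr r + b / (a + b) * (a + b) powr r"
    using pos by (simp flip: distrib_right add_divide_distrib)
  also have "\<dots> \<le> a powr r + b powr r"
    by (intro add_mono *) (use assms in auto)
  finally show ?thesis .
qed (use assms in auto)

lemma powr_add_one:
  fixes a r :: real
  assumes "0 \<le> a" "r \<noteq> 0"
  shows "a powr (r + 1) = a powr r * a"
  using assms by (simp add: powr_add)

lemma powr_add_two:
  fixes a r :: real
  assumes "0 \<le> a"
  shows "a powr (r + 2) = a powr r * a\<^sup>2"
  using assms by (simp add: powr_add)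

text \<open>With \<open>p = r + 2\<close>, subadditivity splits \<open>(a + b) powr r\<close> and
  the square is expanded. The pure powers keep the coefficient 1; all other terms are mixed and
  later integrate to \<open>O(S)\<close>.\<close>

lemma powr_add_le_mixed:
  fixes a b p :: real
  assumes "0 \<le> a" "0 \<le> b" "2 < p" "p \<le> 3"
  shows "(a + b) powr p \<le> a powr p + b powr p + 2 * (a powr (p - 1) * b + a * b powr (p - 1))
           + (a powr (p - 2) * b\<^sup>2 + a\<^sup>2 * b powr (p - 2))"
proof -
  define r where "r = p - 2"
  have p: "p = r + 2" "p - 1 = r + 1" "p - 2 = r" and r: "0 < r" "r \<le> 1"
    using assms by (auto simp: r_def)
  have "(a + b) powr p = (a + b) powr r * (a + b)\<^sup>2"
    unfolding p using assms by (intro powr_add_two) auto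
  also have "\<dots> \<le> (a powr r + b powr r) * (a + b)\<^sup>2"
    by (intro mult_right_mono powr_subadditive) (use assms r in auto)
  also have "\<dots> = a powr p + b powr p + 2 * (a powr (p - 1) * b + a * b powr (p - 1))
           + (a powr (p - 2) * b\<^sup>2 + a\<^sup>2 * b powr (p - 2))"
    unfolding p powr_add_two[OF assms(1)] powr_add_two[OF assms(2)]
    using assms r by (simp add: powr_add power2_eq_square algebra_simps)
  finally show ?thesis .
qed

text \<open>Let \<open>t\<close> be the smaller number. Bernoulli for \<open>1 - t / s\<close> costs
  \<open>k\<close> mixed terms, and absorbing the smaller pure power by
  \<open>t powr k \<le> s powr (k - 1) * t\<close> costs one more, hence the factor
  \<open>k + 1\<close>.\<close>

lemma powr_abs_diff_ge:
  fixes a b k :: real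
  assumes "0 \<le> a" "0 \<le> b" "1 < k"
  shows "a powr k + b powr k - (k + 1) * (a powr (k - 1) * b + a * b powr (k - 1))
    \<le> \<bar>a - b\<bar> powr k"
proof -
  have *: "s powr k + t powr k - (k + 1) * (s powr (k - 1) * t + s * t powr (k - 1)) \<le> \<bar>s - t\<bar> powr k"
    if "0 \<le> t" "t \<le> s" for s t :: real
  proof (cases "s = 0")
    case False
    then have s: "0 < s" using that by auto
    have "1 + k * ((1 - t / s) - 1) \<le> (1 - t / s) powr k"
      by (rule powr_ge_tangent) (use assms that s in auto)
    then have "s powr k * (1 - k * (t / s)) \<le> s powr k * (1 - t / s) powr k"
      by (intro mult_left_mono) auto
    also have "\<dots> = (s * (1 - t / s)) powr k"
      using that s by (simp add: powr_mult)
    also have "s * (1 - t / s) = \<bar>s - t\<bar>" using that s by (simp add: field_simps)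
    finally have 1: "s powr k - k * (s powr (k - 1) * t) \<le> \<bar>s - t\<bar> powr k"
      using s by (simp add: powr_diff field_simps)
    have "t powr k = t powr (k - 1) * t"
      using powr_add_one[of t "k - 1"] that assms by simp
    also have "\<dots> \<le> s powr (k - 1) * t"
      by (intro mult_right_mono powr_mono2) (use assms that in auto)
    finally have 2: "t powr k \<le> s powr (k - 1) * t" .
    have "0 \<le> (k + 1) * (s * t powr (k - 1))" using assms that s by auto
    then show ?thesis using 1 2 by (simp add: algebra_simps)
  qed (use that in auto)
  show ?thesis
  proof (cases "b \<le> a")
    case False
    then show ?thesis using *[of a b] assms by (simp add: abs_minus_commute algebra_simps)
  qed (use * assms in auto)
qed

text \<open>Serves as the lower bound for the loss part of the collision term. For
  \<open>t = |y| / |x|\<close> at most 1 it combines \<open>1 - t \<le> (1 - t) powr g\<close> with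
  \<open>|x| - |y| \<le> |x - y|\<close>; for larger \<open>t\<close> the left side is not
  positive.\<close>

lemma powr_times_abs_diff_ge:
  fixes x y k g :: real
  assumes "0 < g" "g \<le> 1" "0 < k"
  shows "\<bar>x\<bar> powr (k + g) - \<bar>x\<bar> powr (k + g - 1) * \<bar>y\<bar> \<le> \<bar>x\<bar> powr k * \<bar>x - y\<bar> powr g"
proof (cases "x = 0")
  case False
  define t where "t = \<bar>y\<bar> / \<bar>x\<bar>"
  have "\<bar>x\<bar> powr (k + g) - \<bar>x\<bar> powr (k + g - 1) * \<bar>y\<bar> = \<bar>x\<bar> powr k * \<bar>x\<bar> powr g * (1 - t)"
    using False by (simp add: t_def powr_add powr_diff field_simps)
  also have "\<dots> \<le> \<bar>x\<bar> powr k * \<bar>x - y\<bar> powr g"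
  proof (cases "t \<le> 1")
    case True
    have t0: "0 \<le> t" by (simp add: t_def)
    have "1 - t \<le> (1 - t) powr g"
      using powr_mono'[of g 1 "1 - t"] assms True t0 by simp
    then have "\<bar>x\<bar> powr g * (1 - t) \<le> \<bar>x\<bar> powr g * (1 - t) powr g"
      by (intro mult_left_mono) auto
    also have "\<dots> = (\<bar>x\<bar> * (1 - t)) powr g"
      using True by (simp add: powr_mult)
    also have "\<bar>x\<bar> * (1 - t) = \<bar>x\<bar> - \<bar>y\<bar>" using False by (simp add: t_def field_simps)
    also have "(\<bar>x\<bar> - \<bar>y\<bar>) powr g \<le> \<bar>x - y\<bar> powr g"
    proof (rule powr_mono2)
      show "0 \<le> \<bar>x\<bar> - \<bar>y\<bar>" using True False by (simp add: t_def field_simps)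
    qed (use assms in auto)
    finally show ?thesis by (simp add: mult.assoc mult_left_mono)
  next
    case False
    then have "\<bar>x\<bar> powr k * \<bar>x\<bar> powr g * (1 - t) \<le> 0"
      by (intro mult_nonneg_nonpos) auto
    then show ?thesis
      by (rule order_trans) auto
  qed
  finally show ?thesis .
qed (use assms in auto)

text \<open>Bernoulli in the variable \<open>t\<^sup>2\<close> with exponent
  \<open>1 + g / 2\<close>.\<close>

lemma powr_gain_superlinear:
  fixes t g :: real
  assumes "0 \<le> t" "0 < g"
  shows "g / 2 * (t\<^sup>2 - 1) \<le> t powr (2 + g) - t\<^sup>2"
proof -
  have "1 + (1 + g / 2) * (t\<^sup>2 - 1) \<le> (t\<^sup>2) powr (1 + g / 2)"
    by (rule powr_ge_tangent) (use assms in auto)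
  also have "(t\<^sup>2) powr (1 + g / 2) = (t powr 2) powr (1 + g / 2)" using assms by simp
  also have "\<dots> = t powr (2 + g)" unfolding powr_powr by (simp add: algebra_simps)
  finally show ?thesis by (simp add: algebra_simps)
qed

text \<open>This is \<open>(t powr (k - 2) - 1) * (t powr g - 1) \<ge> 0\<close> multiplied by \<open>t\<^sup>2\<close>.\<close>
lemma powr_gain_monotone:
  fixes t g k :: real
  assumes "0 \<le> t" "0 < g" "2 < k"
  shows "t powr (2 + g) - t\<^sup>2 \<le> t powr (k + g) - t powr k"
proof (cases "t = 0")
  case False
  then have t: "0 < t" using assms by simp
  have "0 \<le> (t powr (k - 2) - 1) * (t powr g - 1)"
  proof (cases "1 \<le> t")
    case True
    then show ?thesis
      using assms by (intro mult_nonneg_nonneg) (auto simp: ge_one_powr_ge_zero)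
  next
    case False
    then show ?thesis
      using assms t by (intro mult_nonpos_nonpos) (auto simp: powr_le1)
  qed
  then have "0 \<le> t\<^sup>2 * ((t powr (k - 2) - 1) * (t powr g - 1))" by simp
  also have "\<dots> = t powr k * t powr g - t powr k - t\<^sup>2 * t powr g + t\<^sup>2"
    using t by (simp add: powr_diff field_simps)
  finally show ?thesis using t by (simp add: powr_add algebra_simps)
qed (use assms in auto)

text \<open>Bernoulli in the variable \<open>t powr g\<close>, multiplied by
  \<open>t\<^sup>2\<close>. The exponent \<open>(k - 2) / g\<close> is at least 1 because
  \<open>2 + g \<le> k\<close>.\<close>

lemma powr_gain_compare:
  fixes t g k :: real
  assumes "0 \<le> t" "0 < g" "2 + g \<le> k"
  shows "(k - 2) / g * (t powr (2 + g) - t\<^sup>2) \<le> t powr k - t\<^sup>2"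
proof (cases "t = 0")
  case False
  then have t: "0 < t" using assms by simp
  have "1 + (k - 2) / g * (t powr g - 1) \<le> (t powr g) powr ((k - 2) / g)"
    by (rule powr_ge_tangent) (use assms in auto)
  also have "\<dots> = t powr (k - 2)" using assms by (simp add: powr_powr)
  finally have "t\<^sup>2 * ((k - 2) / g * (t powr g - 1)) \<le> t\<^sup>2 * (t powr (k - 2) - 1)"
    by (intro mult_left_mono) auto
  moreover have "t powr k = t\<^sup>2 * t powr (k - 2)" using t by (simp add: powr_diff)
  moreover have "t powr (2 + g) = t\<^sup>2 * t powr g" using t by (simp add: powr_add)
  moreover have "t\<^sup>2 * ((k - 2) / g * (t powr g - 1)) = (k - 2) / g * (t\<^sup>2 * t powr g - t\<^sup>2)"
    using assms by (simp add: field_simps)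
  moreover have "t\<^sup>2 * (t powr (k - 2) - 1) = t\<^sup>2 * t powr (k - 2) - t\<^sup>2"
    by (simp add: right_diff_distrib)
  ultimately show ?thesis by (simp only:)
qed (use assms in auto)

subsection \<open>Smooth bounded truncations of \<open>\<bar>x\<bar>\<^sup>k\<close>\<close>

text \<open>Away from 0 this is the usual rule on each half-line. At 0 the difference quotient is
  bounded by \<open>|h| powr (k - 1)\<close>, which tends to 0 because \<open>1 < k\<close>.\<close>

lemma has_real_derivative_abs_powr:
  fixes x k :: real
  assumes "1 < k"
  shows "((\<lambda>x. \<bar>x\<bar> powr k) has_real_derivative k * (sgn x * \<bar>x\<bar> powr (k - 1))) (at x)"
proof -
  consider "0 < x" | "x < 0" | "x = 0" by linarith
  then show ?thesis
  proof cases
    case 1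
    have "((\<lambda>x. x powr k) has_real_derivative k * (sgn x * \<bar>x\<bar> powr (k - 1))) (at x)"
      using has_real_derivative_powr[OF 1, of k] 1 by simp
    then show ?thesis
      by (rule has_field_derivative_transform_within_open[where S = "{0<..}"]) (use 1 in auto)
  next
    case 2
    have "((\<lambda>x. (- x) powr k) has_real_derivative k * (- x) powr (k - 1) * - 1) (at x)"
      by (rule DERIV_chain2[OF has_real_derivative_powr]) (use 2 in \<open>auto intro!: derivative_eq_intros\<close>)
    then have "((\<lambda>x. (- x) powr k) has_real_derivative k * (sgn x * \<bar>x\<bar> powr (k - 1))) (at x)"
      using 2 by simp
    then show ?thesis
      by (rule has_field_derivative_transform_within_open[where S = "{..<0}"]) (use 2 in auto)
  next
    case 3
    have "((\<lambda>h::real. \<bar>h\<bar> powr (k - 1)) \<longlongrightarrow> \<bar>0\<bar> powr (k - 1)) (at 0)"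
      by (rule tendsto_powr') (use assms in \<open>auto intro!: tendsto_eq_intros\<close>)
    then have lim: "((\<lambda>h::real. \<bar>h\<bar> powr (k - 1)) \<longlongrightarrow> 0) (at 0)" by simp
    have "((\<lambda>h::real. (\<bar>0 + h\<bar> powr k - \<bar>0\<bar> powr k) / h) \<longlongrightarrow> 0) (at 0)"
    proof (rule Lim_null_comparison[OF _ lim])
      show "\<forall>\<^sub>F h in at 0. norm ((\<bar>0 + h\<bar> powr k - \<bar>0\<bar> powr k) / h) \<le> \<bar>h::real\<bar> powr (k - 1)"
        by (rule always_eventually) (auto simp: powr_diff)
    qed
    then show ?thesis using 3 by (simp add: DERIV_def)
  qed
qed

lemma continuous_on_sgn_abs_powr:
  fixes r :: real
  assumes "0 < r"
  shows "continuous_on S (\<lambda>x::real. sgn x * \<bar>x\<bar> powr r)"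
proof -
  \<comment> \<open>The positive and negative parts are separated: each is a positive power of a
    nonnegative continuous function.\<close>
  have "(\<lambda>x::real. sgn x * \<bar>x\<bar> powr r) = (\<lambda>x. max x 0 powr r - max (- x) 0 powr r)"
    by (auto simp: fun_eq_iff sgn_if max_def)
  then show ?thesis
    by (simp only:) (intro continuous_on_diff continuous_on_powr' continuous_intros; use assms in simp)
qed

text \<open>For \<open>N > 0\<close> this is \<open>u / (1 + u / N)\<close> with
  \<open>u = |x| powr k\<close>. Like \<open>min u N\<close> it lies below both \<open>u\<close> and
  \<open>N\<close>, but for \<open>1 < k\<close> it is also continuously differentiable, as a test
  function must be.\<close>

definition truncated_powr :: "real \<Rightarrow> real \<Rightarrow> real \<Rightarrow> real" where
  "truncated_powr k N x = \<bar>x\<bar> powr k / (1 + \<bar>x\<bar> powr k / N)"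

lemma truncated_powr_bounds:
  assumes "0 < N"
  shows "0 \<le> truncated_powr k N x" "truncated_powr k N x \<le> \<bar>x\<bar> powr k" "truncated_powr k N x \<le> N"
proof -
  have *: "1 \<le> 1 + \<bar>x\<bar> powr k / N" using assms by simp
  then have pos: "0 < 1 + \<bar>x\<bar> powr k / N" by linarith
  show "0 \<le> truncated_powr k N x" using pos by (simp add: truncated_powr_def)
  show "truncated_powr k N x \<le> \<bar>x\<bar> powr k"
    using pos * by (simp add: truncated_powr_def pos_divide_le_eq mult_left_le mult_le_cancel_left1)
  show "truncated_powr k N x \<le> N"
    using pos assms by (simp add: truncated_powr_def pos_divide_le_eq distrib_left)
qed

lemma has_real_derivative_truncated_powr:
  assumes "1 < k" "0 < N"
  shows "(truncated_powr k N has_real_derivative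
           k * (sgn x * \<bar>x\<bar> powr (k - 1)) / (1 + \<bar>x\<bar> powr k / N)\<^sup>2) (at x)"
proof -
  have "1 \<le> 1 + \<bar>x\<bar> powr k / N" using assms by simp
  then have pos: "1 + \<bar>x\<bar> powr k / N \<noteq> 0" by linarith
  note h = has_real_derivative_abs_powr[OF assms(1), of x]
  have "((\<lambda>x. 1 + \<bar>x\<bar> powr k / N) has_real_derivative
      k * (sgn x * \<bar>x\<bar> powr (k - 1)) / N) (at x)"
    using DERIV_add[OF DERIV_const[of 1] DERIV_cdivide[OF h, of N]] by simp
  from DERIV_divide[OF h this pos]
  have "(truncated_powr k N has_real_derivative
      (k * (sgn x * \<bar>x\<bar> powr (k - 1)) * (1 + \<bar>x\<bar> powr k / N)
        - \<bar>x\<bar> powr k * (k * (sgn x * \<bar>x\<bar> powr (k - 1)) / N))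
      / ((1 + \<bar>x\<bar> powr k / N) * (1 + \<bar>x\<bar> powr k / N))) (at x)"
    unfolding truncated_powr_def by simp
  \<comment> \<open>In the numerator of the quotient rule the terms containing \<open>u / N\<close>
    cancel, so only the derivative of the power remains.\<close>
  moreover have "d * (1 + u / N) - u * (d / N) = d" for d u :: real
    by (simp add: distrib_left)
  ultimately show ?thesis by (simp add: power2_eq_square)
qed

lemma deriv_truncated_powr:
  assumes "1 < k" "0 < N"
  shows "deriv (truncated_powr k N) x = k * (sgn x * \<bar>x\<bar> powr (k - 1)) / (1 + \<bar>x\<bar> powr k / N)\<^sup>2"
  using has_real_derivative_truncated_powr[OF assms] by (rule DERIV_imp_deriv)

text \<open>The derivative is bounded through \<open>|x| powr (k - 1) \<le> 1 + u \<le> N * (1 + u /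
  N) \<le> N * (1 + u / N)\<^sup>2\<close> with \<open>u = |x| powr k\<close>; the middle inequality
  uses \<open>1 \<le> N\<close>.\<close>

lemma truncated_powr_C1_bounded:
  assumes k: "1 < k" and N: "1 \<le> N"
  shows "truncated_powr k N \<in> C1_bounded"
proof -
  have N0: "0 < N" using N by simp
  have "\<bar>truncated_powr k N x\<bar> \<le> N" for x
    using truncated_powr_bounds[OF N0, of k x] by simp
  then have 1: "bounded (range (truncated_powr k N))"
    by (auto simp: bounded_iff)
  have "\<bar>deriv (truncated_powr k N) x\<bar> \<le> k * N" for x
  proof -
    let ?u = "\<bar>x\<bar> powr k"
    have u: "0 \<le> ?u / N" using N0 by simp
    have "\<bar>sgn x * \<bar>x\<bar> powr (k - 1)\<bar> \<le> \<bar>x\<bar> powr (k - 1)"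
      by (simp add: abs_mult sgn_if)
    also have "\<dots> \<le> 1 + ?u"
    proof (cases "1 \<le> \<bar>x\<bar>")
      case True
      then have "\<bar>x\<bar> powr (k - 1) \<le> ?u" by (intro powr_mono) auto
      then show ?thesis by simp
    next
      case False
      then have "\<bar>x\<bar> powr (k - 1) \<le> 1" using k by (simp add: powr_le1)
      then show ?thesis by (rule order_trans) simp
    qed
    also have "\<dots> \<le> N * (1 + ?u / N)" using N by (simp add: distrib_left)
    also have "\<dots> \<le> N * (1 + ?u / N)\<^sup>2"
      using u N0 by (intro mult_left_mono) (auto intro: self_le_power)
    finally have "\<bar>sgn x * \<bar>x\<bar> powr (k - 1)\<bar> / (1 + ?u / N)\<^sup>2 \<le> N"
    proof (subst pos_divide_le_eq)
      have "0 < 1 + ?u / N" using u by linarith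
      then show "0 < (1 + ?u / N)\<^sup>2" by simp
    qed
    then have "k * (\<bar>sgn x * \<bar>x\<bar> powr (k - 1)\<bar> / (1 + ?u / N)\<^sup>2) \<le> k * N"
      using k by (intro mult_left_mono) auto
    then show ?thesis
      unfolding deriv_truncated_powr[OF k N0] using k by (simp add: abs_mult)
  qed
  then have 2: "bounded (range (deriv (truncated_powr k N)))"
    by (auto simp: bounded_iff)
  have 3: "continuous_on UNIV (deriv (truncated_powr k N))"
  proof -
    have "1 + \<bar>x\<bar> powr k / N \<noteq> 0" for x
    proof -
      have "0 \<le> \<bar>x\<bar> powr k / N" using N0 by simp
      then show ?thesis by linarith
    qed
    moreover have "continuous_on UNIV (\<lambda>x::real. \<bar>x\<bar> powr k)"
      by (rule continuous_on_powr') (use k in \<open>auto intro!: continuous_intros\<close>)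
    moreover have "continuous_on UNIV (\<lambda>x::real. sgn x * \<bar>x\<bar> powr (k - 1))"
      by (rule continuous_on_sgn_abs_powr) (use k in auto)
    moreover have "deriv (truncated_powr k N)
      = (\<lambda>x. k * (sgn x * \<bar>x\<bar> powr (k - 1)) / (1 + \<bar>x\<bar> powr k / N)\<^sup>2)"
      using deriv_truncated_powr[OF k N0] by auto
    ultimately show ?thesis using N0
      by (auto intro!: continuous_intros)
  qed
  have "truncated_powr k N differentiable (at x)" for x
    using has_real_derivative_truncated_powr[OF k N0]
    by (rule differentiableI[OF has_field_derivative_imp_has_derivative])
  then show ?thesis unfolding C1_bounded_def using 1 2 3 by auto
qed

text \<open>The bound is uniform in \<open>N\<close>, so it can dominate the drift term when the
  truncation is removed.\<close>

lemma truncated_powr_deriv_bound: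
  assumes "1 < k" "0 < N"
  shows "\<bar>x * deriv (truncated_powr k N) x\<bar> \<le> k * \<bar>x\<bar> powr k"
proof -
  have u: "0 \<le> \<bar>x\<bar> powr k / N" using assms by simp
  then have ge: "1 \<le> (1 + \<bar>x\<bar> powr k / N)\<^sup>2" by (intro one_le_power) simp
  have "k * \<bar>x\<bar> powr k / (1 + \<bar>x\<bar> powr k / N)\<^sup>2 \<le> k * \<bar>x\<bar> powr k / 1"
  proof (rule divide_left_mono)
    show "0 < (1 + \<bar>x\<bar> powr k / N)\<^sup>2 * 1" using ge by linarith
  qed (use assms ge in auto)
  moreover have "\<bar>x * (k * (sgn x * \<bar>x\<bar> powr (k - 1)))\<bar> = k * \<bar>x\<bar> powr k"
    using assms by (cases "x = 0") (auto simp: abs_mult powr_diff)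
  ultimately show ?thesis
    unfolding deriv_truncated_powr[OF assms] times_divide_eq_right abs_divide by simp
qed

lemma tendsto_truncated_powr:
  "(\<lambda>n. truncated_powr k (real (Suc n)) x) \<longlonglongrightarrow> \<bar>x\<bar> powr k"
proof -
  have "(\<lambda>n. \<bar>x\<bar> powr k / (1 + \<bar>x\<bar> powr k * inverse (real (Suc n)))) \<longlonglongrightarrow> \<bar>x\<bar> powr k / (1 + \<bar>x\<bar> powr k * 0)"
    by (intro tendsto_intros LIMSEQ_inverse_real_of_nat) simp
  then show ?thesis by (simp add: truncated_powr_def divide_inverse)
qed

lemma tendsto_deriv_truncated_powr:
  assumes "1 < k"
  shows "(\<lambda>n. x * deriv (truncated_powr k (real (Suc n))) x) \<longlonglongrightarrow> k * \<bar>x\<bar> powr k"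
proof -
  have "(\<lambda>n. x * (k * (sgn x * \<bar>x\<bar> powr (k - 1)) / (1 + \<bar>x\<bar> powr k * inverse (real (Suc n)))\<^sup>2))
    \<longlonglongrightarrow> x * (k * (sgn x * \<bar>x\<bar> powr (k - 1)) / (1 + \<bar>x\<bar> powr k * 0)\<^sup>2)"
    by (intro tendsto_intros LIMSEQ_inverse_real_of_nat) simp
  moreover have "x * (k * (sgn x * \<bar>x\<bar> powr (k - 1))) = k * \<bar>x\<bar> powr k"
    by (cases "x = 0") (auto simp: powr_diff sgn_if)
  ultimately show ?thesis
    using assms by (simp add: deriv_truncated_powr divide_inverse)
qed

subsection \<open>Moments of a steady law\<close>

text \<open>The product weight dominates \<open>|x|\<close>, \<open>|y|\<close>,
  \<open>|(x + y) / 2|\<close> and \<open>|x - y|\<close> simultaneously, and it factorizes, so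
  integrability under a product law reduces to one variable. The 4 is the sum 2 + 1 + 1 of the
  coefficients in the bracket.\<close>

lemma collision_integrand_bound:
  fixes f :: "real \<Rightarrow> real"
  assumes f: "\<And>t. 0 \<le> f t" "\<And>t. f t \<le> \<bar>t\<bar> powr k" and "0 \<le> k" "0 \<le> g"
  shows "\<bar>(2 * f ((x + y) / 2) - f x - f y) * \<bar>x - y\<bar> powr g\<bar>
    \<le> 4 * ((1 + \<bar>x\<bar>) * (1 + \<bar>y\<bar>)) powr (k + g)"
proof -
  let ?w = "(1 + \<bar>x\<bar>) * (1 + \<bar>y\<bar>)"
  have "1 + \<bar>x\<bar> + \<bar>y\<bar> \<le> ?w" by (simp add: algebra_simps)
  moreover have "\<bar>(x + y) / 2\<bar> \<le> \<bar>x\<bar> + \<bar>y\<bar>" "\<bar>x - y\<bar> \<le> \<bar>x\<bar> + \<bar>y\<bar>"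
    using abs_triangle_ineq[of x y] abs_triangle_ineq4[of x y] by (simp_all add: abs_divide)
  ultimately have w: "\<bar>x\<bar> \<le> ?w" "\<bar>y\<bar> \<le> ?w" "\<bar>(x + y) / 2\<bar> \<le> ?w" "\<bar>x - y\<bar> \<le> ?w"
    by linarith+
  have *: "0 \<le> f t" "f t \<le> ?w powr k" if "\<bar>t\<bar> \<le> ?w" for t
    using f(1) order_trans[OF f(2) powr_mono2[OF \<open>0 \<le> k\<close> abs_ge_zero that]] by auto
  have "\<bar>2 * f ((x + y) / 2) - f x - f y\<bar> \<le> 4 * ?w powr k"
    using *[OF w(1)] *[OF w(2)] *[OF w(3)] by linarith
  moreover have "\<bar>x - y\<bar> powr g \<le> ?w powr g"
    using w assms by (intro powr_mono2) auto
  ultimately have "\<bar>2 * f ((x + y) / 2) - f x - f y\<bar> * \<bar>x - y\<bar> powr g \<le> (4 * ?w powr k) * ?w powr g"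
    by (intro mult_mono) auto
  then show ?thesis by (simp add: powr_add abs_mult)
qed

text \<open>The measure stands for \<open>G x dx\<close>, so that moments become expectations and
  collision integrals live on the product law. \<open>no_atom\<close> excludes the Dirac mass at 0,
  which meets the other conditions but has second moment 0. The bound
  \<open>\<gamma> < 1 / 2\<close> keeps the order \<open>5 / 2 + \<gamma>\<close> below 3.\<close>

locale steady_law = prob_space M for M :: "real measure" +
  fixes \<gamma> :: real
  assumes sets_M [measurable_cong]: "sets M = sets borel"
    and integrable_weight: "\<And>s. s < 3 \<Longrightarrow> integrable M (\<lambda>x. (1 + \<bar>x\<bar>) powr s)"
    and mean_zero: "(\<integral>x. x \<partial>M) = 0"
    and no_atom: "emeasure M {0} = 0"
    and \<gamma>: "0 < \<gamma>" "\<gamma> < 1 / 2"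
    and weak_form: "\<And>\<phi>. \<phi> \<in> C1_bounded \<Longrightarrow>
      - (1 / 4) * (\<integral>x. x * deriv \<phi> x \<partial>M) =
        1 / 2 * (\<integral>z. (2 * \<phi> ((fst z + snd z) / 2) - \<phi> (fst z) - \<phi> (snd z)) * \<bar>fst z - snd z\<bar> powr \<gamma>
          \<partial>(M \<Otimes>\<^sub>M M))"
begin

sublocale MM: pair_prob_space M M
  by standard

abbreviation m :: "real \<Rightarrow> real" where
  "m s \<equiv> \<integral>x. \<bar>x\<bar> powr s \<partial>M"

abbreviation A :: "real \<Rightarrow> real" where
  "A s \<equiv> \<integral>z. \<bar>fst z - snd z\<bar> powr s \<partial>(M \<Otimes>\<^sub>M M)"

section \<open>Independence and integrability under the product law\<close>

lemma
  fixes u v :: "real \<Rightarrow> real"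
  assumes u: "integrable M u" and v: "integrable M v"
  shows integrable_times: "integrable (M \<Otimes>\<^sub>M M) (\<lambda>z. u (fst z) * v (snd z))"
    and integral_times: "(\<integral>z. u (fst z) * v (snd z) \<partial>(M \<Otimes>\<^sub>M M)) = (\<integral>x. u x \<partial>M) * (\<integral>x. v x \<partial>M)"
proof -
  have [measurable]: "u \<in> borel_measurable M" "v \<in> borel_measurable M"
    using assms by auto
  show *: "integrable (M \<Otimes>\<^sub>M M) (\<lambda>z. u (fst z) * v (snd z))"
  proof (rule MM.Fubini_integrable)
    show "integrable M (\<lambda>x. \<integral>y. norm (u (fst (x, y)) * v (snd (x, y))) \<partial>M)"
      using u by (simp add: abs_mult)
    show "AE x in M. integrable M (\<lambda>y. u (fst (x, y)) * v (snd (x, y)))"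
      using v by simp
  qed measurable
  show "(\<integral>z. u (fst z) * v (snd z) \<partial>(M \<Otimes>\<^sub>M M)) = (\<integral>x. u x \<partial>M) * (\<integral>x. v x \<partial>M)"
    using MM.integral_fst'[OF *] by simp
qed

lemma
  fixes u :: "real \<Rightarrow> real"
  assumes u: "integrable M u"
  shows integrable_fst_law: "integrable (M \<Otimes>\<^sub>M M) (\<lambda>z. u (fst z))"
    and integral_fst_law: "(\<integral>z. u (fst z) \<partial>(M \<Otimes>\<^sub>M M)) = (\<integral>x. u x \<partial>M)"
    and integrable_snd_law: "integrable (M \<Otimes>\<^sub>M M) (\<lambda>z. u (snd z))"
    and integral_snd_law: "(\<integral>z. u (snd z) \<partial>(M \<Otimes>\<^sub>M M)) = (\<integral>x. u x \<partial>M)"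
  using integrable_times[OF u, of "\<lambda>_. 1"] integral_times[OF u, of "\<lambda>_. 1"]
    integrable_times[OF _ u, of "\<lambda>_. 1"] integral_times[OF _ u, of "\<lambda>_. 1"]
  by (simp_all add: prob_space)

lemma integrable_dominated:
  fixes F :: "real \<times> real \<Rightarrow> real"
  assumes "F \<in> borel_measurable (M \<Otimes>\<^sub>M M)" "s < 3"
    and "\<And>x y. \<bar>F (x, y)\<bar> \<le> C * ((1 + \<bar>x\<bar>) * (1 + \<bar>y\<bar>)) powr s"
  shows "integrable (M \<Otimes>\<^sub>M M) F"
proof (rule Bochner_Integration.integrable_bound)
  show "integrable (M \<Otimes>\<^sub>M M) (\<lambda>z. C * ((1 + \<bar>fst z\<bar>) powr s * (1 + \<bar>snd z\<bar>) powr s))"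
    by (intro integrable_mult_right integrable_times integrable_weight assms)
  show "AE z in M \<Otimes>\<^sub>M M. norm (F z) \<le> norm (C * ((1 + \<bar>fst z\<bar>) powr s * (1 + \<bar>snd z\<bar>) powr s))"
  proof (rule AE_I2)
    fix z :: "real \<times> real"
    obtain x y where z: "z = (x, y)" by fastforce
    have "\<bar>F (x, y)\<bar> \<le> C * ((1 + \<bar>x\<bar>) powr s * (1 + \<bar>y\<bar>) powr s)"
      using assms(3)[of x y] by (simp add: powr_mult)
    then show "norm (F z) \<le> norm (C * ((1 + \<bar>fst z\<bar>) powr s * (1 + \<bar>snd z\<bar>) powr s))"
      unfolding z by simp
  qed
qed (rule assms)

lemma integrable_abs_powr:
  assumes "0 \<le> s" "s < 3"
  shows "integrable M (\<lambda>x. \<bar>x\<bar> powr s)"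
proof (rule Bochner_Integration.integrable_bound[OF integrable_weight[OF assms(2)]])
  show "AE x in M. norm (\<bar>x\<bar> powr s) \<le> norm ((1 + \<bar>x\<bar>) powr s)"
    using assms by (auto intro!: AE_I2 powr_mono2)
qed measurable

lemma integrable_identity: "integrable M (\<lambda>x. x)"
proof (rule Bochner_Integration.integrable_bound)
  show "integrable M (\<lambda>x. \<bar>x\<bar> powr 1)" by (rule integrable_abs_powr) auto
qed auto

lemma integrable_diff_powr:
  assumes "0 \<le> s" "s < 3"
  shows "integrable (M \<Otimes>\<^sub>M M) (\<lambda>z. \<bar>fst z - snd z\<bar> powr s)"
proof (rule integrable_dominated[OF _ assms(2), of _ 1])
  fix x y :: real
  have "\<bar>x - y\<bar> \<le> \<bar>x\<bar> + \<bar>y\<bar>" by linarith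
  also have "\<dots> \<le> (1 + \<bar>x\<bar>) * (1 + \<bar>y\<bar>)" by (simp add: algebra_simps)
  finally show "\<bar>\<bar>fst (x, y) - snd (x, y)\<bar> powr s\<bar> \<le> 1 * ((1 + \<bar>x\<bar>) * (1 + \<bar>y\<bar>)) powr s"
    using assms by (simp add: powr_mono2)
qed measurable

text \<open>Powers are unbounded, so the equation is tested with their truncations and both sides
  pass to the limit by dominated convergence. The condition \<open>k + \<gamma> < 3\<close> makes
  the dominating product weight integrable.\<close>

lemma weak_form_powr:
  assumes k: "1 < k" "k + \<gamma> < 3"
  shows "- (k / 4) * m k = 1 / 2 * (\<integral>z. (2 * \<bar>(fst z + snd z) / 2\<bar> powr k - \<bar>fst z\<bar> powr k - \<bar>snd z\<bar> powr k)
      * \<bar>fst z - snd z\<bar> powr \<gamma> \<partial>(M \<Otimes>\<^sub>M M))"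
proof -
  \<comment> \<open>\<open>Suc n\<close> keeps the truncation level at least 1, as
    \<open>truncated_powr_C1_bounded\<close> requires.\<close>
  define \<phi> where "\<phi> n = truncated_powr k (real (Suc n))" for n
  have meas [measurable]: "\<phi> n \<in> borel_measurable borel" for n
    unfolding \<phi>_def truncated_powr_def by measurable
  have meas_deriv [measurable]: "deriv (\<phi> n) \<in> borel_measurable borel" for n
    using truncated_powr_C1_bounded[OF k(1), of "real (Suc n)"]
    unfolding \<phi>_def C1_bounded_def by (auto intro: borel_measurable_continuous_onI)
  have k3: "k < 3" using k \<gamma> by simp
  have bounds: "0 \<le> \<phi> n x" "\<phi> n x \<le> \<bar>x\<bar> powr k" for n x
    unfolding \<phi>_def by (rule truncated_powr_bounds; simp)+
  have "(\<lambda>n. - (1 / 4) * (\<integral>x. x * deriv (\<phi> n) x \<partial>M)) \<longlonglongrightarrow> - (1 / 4) * (\<integral>x. k * \<bar>x\<bar> powr k \<partial>M)"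
  proof (intro tendsto_mult_left integral_dominated_convergence)
    show "integrable M (\<lambda>x. k * \<bar>x\<bar> powr k)"
      using k k3 by (intro integrable_mult_right integrable_abs_powr) auto
    show "AE x in M. (\<lambda>n. x * deriv (\<phi> n) x) \<longlonglongrightarrow> k * \<bar>x\<bar> powr k"
      unfolding \<phi>_def using tendsto_deriv_truncated_powr[OF k(1)] by simp
    show "AE x in M. norm (x * deriv (\<phi> n) x) \<le> k * \<bar>x\<bar> powr k" for n
      unfolding \<phi>_def using truncated_powr_deriv_bound[OF k(1)] by simp
  qed measurable
  then have left: "(\<lambda>n. - (1 / 4) * (\<integral>x. x * deriv (\<phi> n) x \<partial>M)) \<longlonglongrightarrow> - (k / 4) * m k"
    by simp
  let ?W = "\<lambda>z. (1 + \<bar>fst z\<bar>) powr (k + \<gamma>) * (1 + \<bar>snd z\<bar>) powr (k + \<gamma>) :: real"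
  have right: "(\<lambda>n. 1 / 2 * (\<integral>z. (2 * \<phi> n ((fst z + snd z) / 2) - \<phi> n (fst z) - \<phi> n (snd z))
      * \<bar>fst z - snd z\<bar> powr \<gamma> \<partial>(M \<Otimes>\<^sub>M M)))
    \<longlonglongrightarrow> 1 / 2 * (\<integral>z. (2 * \<bar>(fst z + snd z) / 2\<bar> powr k - \<bar>fst z\<bar> powr k - \<bar>snd z\<bar> powr k)
      * \<bar>fst z - snd z\<bar> powr \<gamma> \<partial>(M \<Otimes>\<^sub>M M))"
  proof (intro tendsto_mult_left integral_dominated_convergence)
    show "integrable (M \<Otimes>\<^sub>M M) (\<lambda>z. 4 * ?W z)"
      using k by (intro integrable_mult_right integrable_times integrable_weight) auto
    show "AE z in M \<Otimes>\<^sub>M M. (\<lambda>n. (2 * \<phi> n ((fst z + snd z) / 2) - \<phi> n (fst z) - \<phi> n (snd z))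
        * \<bar>fst z - snd z\<bar> powr \<gamma>)
      \<longlonglongrightarrow> (2 * \<bar>(fst z + snd z) / 2\<bar> powr k - \<bar>fst z\<bar> powr k - \<bar>snd z\<bar> powr k) * \<bar>fst z - snd z\<bar> powr \<gamma>"
      unfolding \<phi>_def by (intro AE_I2 tendsto_intros tendsto_truncated_powr)
    show "AE z in M \<Otimes>\<^sub>M M. norm ((2 * \<phi> n ((fst z + snd z) / 2) - \<phi> n (fst z) - \<phi> n (snd z))
        * \<bar>fst z - snd z\<bar> powr \<gamma>) \<le> 4 * ?W z" for n
    proof (rule AE_I2)
      fix z :: "real \<times> real"
      show "norm ((2 * \<phi> n ((fst z + snd z) / 2) - \<phi> n (fst z) - \<phi> n (snd z))
        * \<bar>fst z - snd z\<bar> powr \<gamma>) \<le> 4 * ?W z"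
        using collision_integrand_bound[of "\<phi> n" k, OF bounds, where g = \<gamma> and x = "fst z" and y = "snd z"] k \<gamma>
        by (simp add: powr_mult)
    qed
  qed measurable
  have eq: "- (1 / 4) * (\<integral>x. x * deriv (\<phi> n) x \<partial>M) =
      1 / 2 * (\<integral>z. (2 * \<phi> n ((fst z + snd z) / 2) - \<phi> n (fst z) - \<phi> n (snd z))
        * \<bar>fst z - snd z\<bar> powr \<gamma> \<partial>(M \<Otimes>\<^sub>M M))" for n
    unfolding \<phi>_def by (rule weak_form, rule truncated_powr_C1_bounded[OF k(1)]) simp
  show ?thesis
    using left right unfolding eq by (rule LIMSEQ_unique)
qed

section \<open>Second-order identities and the upper bound\<close>

text \<open>By independence the cross term integrates to the square of the mean, which is 0.\<close>

lemma diff_moment_two: "A 2 = 2 * m 2"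
proof -
  have sq: "integrable M (\<lambda>x. x\<^sup>2)" and m2: "m 2 = (\<integral>x. x\<^sup>2 \<partial>M)"
    using integrable_abs_powr[of 2] by simp_all
  have "A 2 = (\<integral>z. (fst z)\<^sup>2 + (snd z)\<^sup>2 - 2 * (fst z * snd z) \<partial>(M \<Otimes>\<^sub>M M))"
    by (rule Bochner_Integration.integral_cong) (auto simp: power2_diff)
  also have "\<dots> = 2 * m 2"
    using integrable_times[OF integrable_identity integrable_identity]
      integral_times[OF integrable_identity integrable_identity]
      integrable_fst_law[OF sq] integrable_snd_law[OF sq] integral_fst_law[OF sq] integral_snd_law[OF sq]
    by (simp add: mean_zero m2)
  finally show ?thesis .
qed

text \<open>For the square, the collision bracket is exactly
  \<open>- (1 / 2) * (x - y)\<^sup>2\<close>, so the equation becomes an identity between moments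
  with no remainder.\<close>

lemma diff_moment_two_plus: "A (2 + \<gamma>) = 2 * m 2"
proof -
  have "- (2 / 4) * m 2 = 1 / 2 * (\<integral>z. (2 * \<bar>(fst z + snd z) / 2\<bar> powr 2 - \<bar>fst z\<bar> powr 2 - \<bar>snd z\<bar> powr 2)
      * \<bar>fst z - snd z\<bar> powr \<gamma> \<partial>(M \<Otimes>\<^sub>M M))"
    using \<gamma> by (intro weak_form_powr) auto
  also have "(\<integral>z. (2 * \<bar>(fst z + snd z) / 2\<bar> powr 2 - \<bar>fst z\<bar> powr 2 - \<bar>snd z\<bar> powr 2)
      * \<bar>fst z - snd z\<bar> powr \<gamma> \<partial>(M \<Otimes>\<^sub>M M)) = (\<integral>z. - (1 / 2) * \<bar>fst z - snd z\<bar> powr (2 + \<gamma>) \<partial>(M \<Otimes>\<^sub>M M))"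
  proof (rule Bochner_Integration.integral_cong[OF refl])
    fix z :: "real \<times> real"
    have "2 * \<bar>(fst z + snd z) / 2\<bar> powr 2 - \<bar>fst z\<bar> powr 2 - \<bar>snd z\<bar> powr 2 = - (1 / 2) * (fst z - snd z)\<^sup>2"
      by (simp add: power2_eq_square field_simps)
    then show "(2 * \<bar>(fst z + snd z) / 2\<bar> powr 2 - \<bar>fst z\<bar> powr 2 - \<bar>snd z\<bar> powr 2) * \<bar>fst z - snd z\<bar> powr \<gamma>
        = - (1 / 2) * \<bar>fst z - snd z\<bar> powr (2 + \<gamma>)"
      by (simp add: powr_add)
  qed
  finally show ?thesis by simp
qed

text \<open>Integrating \<open>powr_gain_superlinear\<close> over \<open>|x - y|\<close> gives 0 on
  the right, since \<open>A (2 + \<gamma>) = A 2\<close>. What remains is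
  \<open>\<gamma> / 2 * (A 2 - 1) \<le> 0\<close>.\<close>

lemma second_moment_le_half: "m 2 \<le> 1 / 2"
proof -
  have int: "integrable (M \<Otimes>\<^sub>M M) (\<lambda>z. \<bar>fst z - snd z\<bar> powr (2 + \<gamma>))"
    "integrable (M \<Otimes>\<^sub>M M) (\<lambda>z. \<bar>fst z - snd z\<bar> powr 2)"
    using \<gamma> by (intro integrable_diff_powr; simp)+
  have "(\<integral>z. \<gamma> / 2 * (\<bar>fst z - snd z\<bar> powr 2 - 1) \<partial>(M \<Otimes>\<^sub>M M))
      \<le> (\<integral>z. \<bar>fst z - snd z\<bar> powr (2 + \<gamma>) - \<bar>fst z - snd z\<bar> powr 2 \<partial>(M \<Otimes>\<^sub>M M))"
  proof (rule integral_mono)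
    show "\<gamma> / 2 * (\<bar>fst z - snd z\<bar> powr 2 - 1) \<le> \<bar>fst z - snd z\<bar> powr (2 + \<gamma>) - \<bar>fst z - snd z\<bar> powr 2"
      for z :: "real \<times> real"
      using powr_gain_superlinear[of "\<bar>fst z - snd z\<bar>" \<gamma>] \<gamma> by simp
  qed (intro integrable_mult_right Bochner_Integration.integrable_diff int MM.integrable_const)+
  then have "\<gamma> / 2 * (A 2 - 1) \<le> A (2 + \<gamma>) - A 2"
    using int by (simp add: MM.prob_space)
  then have "\<gamma> * (2 * m 2 - 1) \<le> 0"
    unfolding diff_moment_two diff_moment_two_plus by simp
  then show ?thesis using \<gamma> by (simp add: mult_le_0_iff)
qed

text \<open>Otherwise the law would be concentrated at 0, contrary to
  \<open>no_atom\<close>.\<close>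

lemma second_moment_pos: "0 < m 2"
proof (rule ccontr)
  assume "\<not> 0 < m 2"
  then have "m 2 = 0" by (smt (verit) Bochner_Integration.integral_nonneg powr_ge_zero)
  then have "AE x in M. \<bar>x\<bar> powr 2 = 0"
    using integrable_abs_powr[of 2] by (subst (asm) integral_nonneg_eq_0_iff_AE) auto
  moreover have "AE x in M. x \<noteq> 0"
    by (rule AE_I[of _ _ "{0}"]) (auto simp: no_atom sets_M)
  ultimately have "AE x in M. False" by eventually_elim simp
  then show False by simp
qed

section \<open>Mixed moments in terms of the second moment\<close>

text \<open>Lyapunov's inequality. The concave power of \<open>x\<^sup>2 / m 2\<close> lies below
  its tangent at 1, and this variable has mean 1, so the linear correction integrates to 0.\<close>

lemma low_moment_le:
  assumes "0 < r" "r \<le> 2"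
  shows "m r \<le> m 2 powr (r / 2)"
proof -
  let ?s = "m 2"
  have s: "0 < ?s" by (rule second_moment_pos)
  have "m r \<le> (\<integral>x. ?s powr (r / 2) * (1 + r / 2 * (\<bar>x\<bar> powr 2 / ?s - 1)) \<partial>M)"
  proof (rule integral_mono)
    show "integrable M (\<lambda>x. \<bar>x\<bar> powr r)" using assms by (intro integrable_abs_powr) auto
    show "integrable M (\<lambda>x. ?s powr (r / 2) * (1 + r / 2 * (\<bar>x\<bar> powr 2 / ?s - 1)))"
      using integrable_abs_powr[of 2] by simp
    fix x :: real
    have "\<bar>x\<bar> powr r = (x\<^sup>2) powr (r / 2)"
    proof -
      have "(x\<^sup>2) powr (r / 2) = (\<bar>x\<bar> powr 2) powr (r / 2)" by simp
      then show ?thesis unfolding powr_powr by simp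
    qed
    also have "\<dots> = (?s * (x\<^sup>2 / ?s)) powr (r / 2)" using s by simp
    also have "\<dots> = ?s powr (r / 2) * (x\<^sup>2 / ?s) powr (r / 2)" using s by (subst powr_mult) auto
    also have "\<dots> \<le> ?s powr (r / 2) * (1 + r / 2 * (x\<^sup>2 / ?s - 1))"
      by (intro mult_left_mono powr_le_tangent) (use assms s in auto)
    finally show "\<bar>x\<bar> powr r \<le> ?s powr (r / 2) * (1 + r / 2 * (\<bar>x\<bar> powr 2 / ?s - 1))" by simp
  qed
  also have "\<dots> = ?s powr (r / 2)"
    using integrable_abs_powr[of 2] s by (simp add: prob_space)
  finally show ?thesis .
qed

lemma integrable_moment_product:
  assumes "0 \<le> r" "r < 3" "0 \<le> s" "s < 3"
  shows "integrable (M \<Otimes>\<^sub>M M) (\<lambda>z. \<bar>fst z\<bar> powr r * \<bar>snd z\<bar> powr s)"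
  by (intro integrable_times integrable_abs_powr assms)

lemma integral_moment_product:
  assumes "0 \<le> r" "r < 3" "0 \<le> s" "s < 3"
  shows "(\<integral>z. \<bar>fst z\<bar> powr r * \<bar>snd z\<bar> powr s \<partial>(M \<Otimes>\<^sub>M M)) = m r * m s"
  by (intro integral_times integrable_abs_powr assms)

lemmas abs_powr_marginal =
  integrable_fst_law[OF integrable_abs_powr] integrable_snd_law[OF integrable_abs_powr]
  integral_fst_law[OF integrable_abs_powr] integral_snd_law[OF integrable_abs_powr]

text \<open>The natural size of a moment of order 5/2. It exceeds the order of \<open>m 2\<close> by
  the power 1/4, which is what finally bounds \<open>m 2\<close> away from 0.\<close>

abbreviation S :: real where
  "S \<equiv> m 2 powr (5 / 4)"

text \<open>The product is at most \<open>m 2 powr ((r + s) / 2)\<close>. Since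
  \<open>m 2 \<le> 1 / 2\<close>, raising the exponent above 5/4 only decreases this, so total
  orders 5/2 and \<open>5 / 2 + \<gamma>\<close> share one bound, free of
  \<open>\<gamma>\<close>.\<close>

lemma mixed_moment_le:
  assumes "0 < r" "r \<le> 2" "0 < s" "s \<le> 2" "5 / 2 \<le> r + s"
  shows "m r * m s \<le> S"
proof -
  have "m r * m s \<le> m 2 powr (r / 2) * m 2 powr (s / 2)"
    by (intro mult_mono low_moment_le Bochner_Integration.integral_nonneg assms) auto
  also have "\<dots> = m 2 powr ((r + s) / 2)" by (simp add: add_divide_distrib powr_add)
  also have "\<dots> \<le> S"
    using second_moment_pos second_moment_le_half assms by (intro powr_mono') auto
  finally show ?thesis .
qed

lemma integrable_sum_powr:
  assumes "0 \<le> s" "s < 3"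
  shows "integrable (M \<Otimes>\<^sub>M M) (\<lambda>z. (\<bar>fst z\<bar> + \<bar>snd z\<bar>) powr s)"
proof (rule integrable_dominated[OF _ assms(2), of _ 1])
  fix x y :: real
  have "\<bar>x\<bar> + \<bar>y\<bar> \<le> (1 + \<bar>x\<bar>) * (1 + \<bar>y\<bar>)" by (simp add: algebra_simps)
  then show "\<bar>(\<bar>fst (x, y)\<bar> + \<bar>snd (x, y)\<bar>) powr s\<bar> \<le> 1 * ((1 + \<bar>x\<bar>) * (1 + \<bar>y\<bar>)) powr s"
    using assms by (simp add: powr_mono2)
qed measurable

text \<open>Integrates \<open>powr_add_le_mixed\<close>; the six mixed terms, counted with
  coefficients 2, 2, 1, 1, are each at most \<open>S\<close>.\<close>

lemma sum_moment_le:
  assumes "5 / 2 \<le> q" "q < 3"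
  shows "(\<integral>z. (\<bar>fst z\<bar> + \<bar>snd z\<bar>) powr q \<partial>(M \<Otimes>\<^sub>M M)) \<le> 2 * m q + 6 * S"
proof -
  define T where "T r s z = \<bar>fst z\<bar> powr r * \<bar>snd z\<bar> powr s" for r s and z :: "real \<times> real"
  define X where "X z = \<bar>fst z\<bar> powr q" for z :: "real \<times> real"
  define Y where "Y z = \<bar>snd z\<bar> powr q" for z :: "real \<times> real"
  let ?R = "\<lambda>z. X z + Y z + 2 * (T (q - 1) 1 z + T 1 (q - 1) z)
      + (T (q - 2) 2 z + T 2 (q - 2) z)"
  have int: "integrable (M \<Otimes>\<^sub>M M) (T (q - 1) 1)" "integrable (M \<Otimes>\<^sub>M M) (T 1 (q - 1))"
    "integrable (M \<Otimes>\<^sub>M M) (T (q - 2) 2)" "integrable (M \<Otimes>\<^sub>M M) (T 2 (q - 2))"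
    "integrable (M \<Otimes>\<^sub>M M) X" "integrable (M \<Otimes>\<^sub>M M) Y"
    using assms unfolding T_def X_def Y_def
    by (intro integrable_moment_product abs_powr_marginal; simp)+
  have val: "integral\<^sup>L (M \<Otimes>\<^sub>M M) (T (q - 1) 1) = m (q - 1) * m 1"
    "integral\<^sup>L (M \<Otimes>\<^sub>M M) (T 1 (q - 1)) = m 1 * m (q - 1)"
    "integral\<^sup>L (M \<Otimes>\<^sub>M M) (T (q - 2) 2) = m (q - 2) * m 2"
    "integral\<^sup>L (M \<Otimes>\<^sub>M M) (T 2 (q - 2)) = m 2 * m (q - 2)"
    "integral\<^sup>L (M \<Otimes>\<^sub>M M) X = m q" "integral\<^sup>L (M \<Otimes>\<^sub>M M) Y = m q"
    using assms unfolding T_def X_def Y_def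
    by (intro integral_moment_product abs_powr_marginal; simp)+
  have mixed: "m (q - 1) * m 1 \<le> S" "m 1 * m (q - 1) \<le> S" "m (q - 2) * m 2 \<le> S" "m 2 * m (q - 2) \<le> S"
    using assms by (intro mixed_moment_le; simp)+
  have "(\<integral>z. (\<bar>fst z\<bar> + \<bar>snd z\<bar>) powr q \<partial>(M \<Otimes>\<^sub>M M)) \<le> integral\<^sup>L (M \<Otimes>\<^sub>M M) ?R"
  proof (rule integral_mono)
    show "integrable (M \<Otimes>\<^sub>M M) (\<lambda>z. (\<bar>fst z\<bar> + \<bar>snd z\<bar>) powr q)"
      using assms by (intro integrable_sum_powr) auto
    show "integrable (M \<Otimes>\<^sub>M M) ?R"
      by (intro Bochner_Integration.integrable_add integrable_mult_right int)
    show "(\<bar>fst z\<bar> + \<bar>snd z\<bar>) powr q \<le> ?R z" for z :: "real \<times> real"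
      using powr_add_le_mixed[of "\<bar>fst z\<bar>" "\<bar>snd z\<bar>" q] assms by (simp add: T_def X_def Y_def)
  qed
  also have "integral\<^sup>L (M \<Otimes>\<^sub>M M) ?R = m q + m q + 2 * (m (q - 1) * m 1 + m 1 * m (q - 1))
      + (m (q - 2) * m 2 + m 2 * m (q - 2))"
    using int val by (simp del: powr_numeral powr_one)
  also have "\<dots> \<le> 2 * m q + 6 * S"
    using add_mono[OF add_mono[OF mixed(1,2)] add_mono[OF mixed(3,4)]] add_mono[OF mixed(1,2)]
    by (simp del: powr_numeral powr_one)
  finally show ?thesis .
qed

section \<open>Moments of the difference near order 5/2\<close>

lemma diff_moment_upper: "A (5 / 2) \<le> 2 * m (5 / 2) + 6 * S"
proof -
  have "A (5 / 2) \<le> (\<integral>z. (\<bar>fst z\<bar> + \<bar>snd z\<bar>) powr (5 / 2) \<partial>(M \<Otimes>\<^sub>M M))"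
    by (intro integral_mono integrable_diff_powr integrable_sum_powr powr_mono2) auto
  also have "\<dots> \<le> 2 * m (5 / 2) + 6 * S" by (rule sum_moment_le) auto
  finally show ?thesis .
qed

lemma diff_moment_plus_upper: "A (5 / 2 + \<gamma>) \<le> 2 * m (5 / 2 + \<gamma>) + 6 * S"
proof -
  have "A (5 / 2 + \<gamma>) \<le> (\<integral>z. (\<bar>fst z\<bar> + \<bar>snd z\<bar>) powr (5 / 2 + \<gamma>) \<partial>(M \<Otimes>\<^sub>M M))"
    using \<gamma> by (intro integral_mono integrable_diff_powr integrable_sum_powr powr_mono2) auto
  also have "\<dots> \<le> 2 * m (5 / 2 + \<gamma>) + 6 * S" using \<gamma> by (intro sum_moment_le) auto
  finally show ?thesis .
qed

text \<open>Integrates \<open>powr_abs_diff_ge\<close> with \<open>k = 5 / 2\<close>: its factor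
  \<open>k + 1 = 7 / 2\<close> multiplies two mixed moments, each at most \<open>S\<close>.\<close>

lemma diff_moment_lower: "2 * m (5 / 2) - 7 * S \<le> A (5 / 2)"
proof -
  define T where "T r s z = \<bar>fst z\<bar> powr r * \<bar>snd z\<bar> powr s" for r s and z :: "real \<times> real"
  define X where "X z = \<bar>fst z\<bar> powr (5 / 2)" for z :: "real \<times> real"
  define Y where "Y z = \<bar>snd z\<bar> powr (5 / 2)" for z :: "real \<times> real"
  let ?R = "\<lambda>z. X z + Y z - 7 / 2 * (T (3 / 2) 1 z + T 1 (3 / 2) z)"
  have int: "integrable (M \<Otimes>\<^sub>M M) (T (3 / 2) 1)" "integrable (M \<Otimes>\<^sub>M M) (T 1 (3 / 2))"
    "integrable (M \<Otimes>\<^sub>M M) X" "integrable (M \<Otimes>\<^sub>M M) Y"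
    unfolding T_def X_def Y_def
    by (intro integrable_moment_product abs_powr_marginal; simp)+
  have val: "integral\<^sup>L (M \<Otimes>\<^sub>M M) (T (3 / 2) 1) = m (3 / 2) * m 1"
    "integral\<^sup>L (M \<Otimes>\<^sub>M M) (T 1 (3 / 2)) = m 1 * m (3 / 2)"
    "integral\<^sup>L (M \<Otimes>\<^sub>M M) X = m (5 / 2)"
    "integral\<^sup>L (M \<Otimes>\<^sub>M M) Y = m (5 / 2)"
    unfolding T_def X_def Y_def
    by (intro integral_moment_product abs_powr_marginal; simp)+
  have mixed: "m (3 / 2) * m 1 \<le> S" "m 1 * m (3 / 2) \<le> S"
    by (intro mixed_moment_le; simp)+
  have "2 * m (5 / 2) - 7 * S \<le> m (5 / 2) + m (5 / 2) - 7 / 2 * (m (3 / 2) * m 1 + m 1 * m (3 / 2))"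
    using add_mono[OF mixed] by (simp del: powr_numeral powr_one)
  also have "\<dots> = integral\<^sup>L (M \<Otimes>\<^sub>M M) ?R"
    using int val by (simp del: powr_numeral powr_one)
  also have "\<dots> \<le> A (5 / 2)"
  proof (rule integral_mono)
    show "integrable (M \<Otimes>\<^sub>M M) ?R"
      by (intro Bochner_Integration.integrable_add Bochner_Integration.integrable_diff integrable_mult_right int)
    show "integrable (M \<Otimes>\<^sub>M M) (\<lambda>z. \<bar>fst z - snd z\<bar> powr (5 / 2))"
      by (intro integrable_diff_powr) auto
    fix z :: "real \<times> real"
    have "?R z \<le> \<bar>\<bar>fst z\<bar> - \<bar>snd z\<bar>\<bar> powr (5 / 2)"
      using powr_abs_diff_ge[of "\<bar>fst z\<bar>" "\<bar>snd z\<bar>" "5 / 2"] by (simp add: T_def X_def Y_def)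
    also have "\<dots> \<le> \<bar>fst z - snd z\<bar> powr (5 / 2)"
      by (rule powr_mono2) (auto simp: abs_triangle_ineq3)
    finally show "?R z \<le> \<bar>fst z - snd z\<bar> powr (5 / 2)" .
  qed
  finally show ?thesis .
qed

text \<open>Integrates \<open>powr_gain_monotone\<close>, whose left side becomes
  \<open>A (2 + \<gamma>) - A 2 = 0\<close>.\<close>

lemma diff_moment_mono: "A (5 / 2) \<le> A (5 / 2 + \<gamma>)"
proof -
  have int: "integrable (M \<Otimes>\<^sub>M M) (\<lambda>z. \<bar>fst z - snd z\<bar> powr s)" if "s \<in> {2, 5/2, 2 + \<gamma>, 5/2 + \<gamma>}" for s
    using that \<gamma> by (intro integrable_diff_powr) auto
  have "(\<integral>z. \<bar>fst z - snd z\<bar> powr (2 + \<gamma>) - \<bar>fst z - snd z\<bar> powr 2 \<partial>(M \<Otimes>\<^sub>M M))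
      \<le> (\<integral>z. \<bar>fst z - snd z\<bar> powr (5 / 2 + \<gamma>) - \<bar>fst z - snd z\<bar> powr (5 / 2) \<partial>(M \<Otimes>\<^sub>M M))"
  proof (rule integral_mono)
    show "\<bar>fst z - snd z\<bar> powr (2 + \<gamma>) - \<bar>fst z - snd z\<bar> powr 2
      \<le> \<bar>fst z - snd z\<bar> powr (5 / 2 + \<gamma>) - \<bar>fst z - snd z\<bar> powr (5 / 2)" for z :: "real \<times> real"
      using powr_gain_monotone[of "\<bar>fst z - snd z\<bar>" \<gamma> "5 / 2"] \<gamma> by simp
  qed (intro Bochner_Integration.integrable_diff int; simp)+
  also have "\<dots> = A (5 / 2 + \<gamma>) - A (5 / 2)"
    by (intro Bochner_Integration.integral_diff int) auto
  also have "(\<integral>z. \<bar>fst z - snd z\<bar> powr (2 + \<gamma>) - \<bar>fst z - snd z\<bar> powr 2 \<partial>(M \<Otimes>\<^sub>M M)) = A (2 + \<gamma>) - A 2"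
    by (intro Bochner_Integration.integral_diff int) auto
  finally show ?thesis unfolding diff_moment_two diff_moment_two_plus by simp
qed

text \<open>Integrates \<open>powr_gain_compare\<close>. The factor \<open>1 / \<gamma>\<close> does
  no harm because it multiplies \<open>A (2 + \<gamma>) - A 2 = 0\<close>.\<close>

lemma diff_moment_two_le: "2 * m 2 \<le> A (5 / 2)"
proof -
  have int: "integrable (M \<Otimes>\<^sub>M M) (\<lambda>z. \<bar>fst z - snd z\<bar> powr s)" if "s \<in> {2, 5/2, 2 + \<gamma>}" for s
    using that \<gamma> by (intro integrable_diff_powr) auto
  have "(\<integral>z. (5 / 2 - 2) / \<gamma> * (\<bar>fst z - snd z\<bar> powr (2 + \<gamma>) - \<bar>fst z - snd z\<bar> powr 2) \<partial>(M \<Otimes>\<^sub>M M))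
      \<le> (\<integral>z. \<bar>fst z - snd z\<bar> powr (5 / 2) - \<bar>fst z - snd z\<bar> powr 2 \<partial>(M \<Otimes>\<^sub>M M))"
  proof (rule integral_mono)
    show "(5 / 2 - 2) / \<gamma> * (\<bar>fst z - snd z\<bar> powr (2 + \<gamma>) - \<bar>fst z - snd z\<bar> powr 2)
      \<le> \<bar>fst z - snd z\<bar> powr (5 / 2) - \<bar>fst z - snd z\<bar> powr 2" for z :: "real \<times> real"
      using powr_gain_compare[of "\<bar>fst z - snd z\<bar>" \<gamma> "5 / 2"] \<gamma> by simp
  qed (intro integrable_mult_right Bochner_Integration.integrable_diff int; simp)+
  also have "\<dots> = A (5 / 2) - A 2"
    by (intro Bochner_Integration.integral_diff int) auto
  also have "(\<integral>z. (5 / 2 - 2) / \<gamma> * (\<bar>fst z - snd z\<bar> powr (2 + \<gamma>) - \<bar>fst z - snd z\<bar> powr 2) \<partial>(M \<Otimes>\<^sub>M M))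
      = (5 / 2 - 2) / \<gamma> * (A (2 + \<gamma>) - A 2)"
    unfolding integral_mult_right_zero
    by (subst Bochner_Integration.integral_diff) (auto intro!: int simp del: powr_numeral)
  finally show ?thesis unfolding diff_moment_two diff_moment_two_plus by simp
qed

section \<open>Povzner estimate and the lower bound\<close>

text \<open>The argument closes because \<open>354 / 1000 < 1 - k / 4 = 3 / 8\<close> for \<open>k = 5 / 2\<close>.\<close>
lemma two_powr_minus_three_halves: "2 powr (- (3 / 2)) \<le> (354 / 1000 :: real)"
proof (rule power2_le_imp_le)
  have "(2 powr (- (3 / 2)) :: real)\<^sup>2 = 2 powr (- 3)"
    by (simp add: power2_eq_square flip: powr_add)
  also have "\<dots> = 1 / 8" by (simp add: powr_minus powr_numeral)
  finally show "(2 powr (- (3 / 2)))\<^sup>2 \<le> (354 / 1000 :: real)\<^sup>2" by (simp add: power2_eq_square)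
qed simp

text \<open>Tests the equation with \<open>|x| powr (5 / 2)\<close>. Averaging the two points
  shrinks the gain by \<open>2 powr (1 - 5 / 2)\<close>, while the loss retains both pure moments of
  order \<open>5 / 2 + \<gamma>\<close> up to mixed terms.\<close>

lemma povzner_estimate:
  "2 * m (5 / 2 + \<gamma>) - 2 * S - 354 / 1000 * (2 * m (5 / 2 + \<gamma>) + 6 * S) \<le> 5 / 4 * m (5 / 2)"
proof -
  let ?p = "5 / 2 + \<gamma>"
  define T where "T r s z = \<bar>fst z\<bar> powr r * \<bar>snd z\<bar> powr s" for r s and z :: "real \<times> real"
  define X where "X z = \<bar>fst z\<bar> powr (5 / 2 + \<gamma>)" for z :: "real \<times> real"
  define Y where "Y z = \<bar>snd z\<bar> powr (5 / 2 + \<gamma>)" for z :: "real \<times> real"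
  let ?B = "\<lambda>z. (\<bar>fst z\<bar> + \<bar>snd z\<bar>) powr ?p :: real"
  let ?F = "\<lambda>z. (2 * \<bar>(fst z + snd z) / 2\<bar> powr (5 / 2) - \<bar>fst z\<bar> powr (5 / 2) - \<bar>snd z\<bar> powr (5 / 2))
      * \<bar>fst z - snd z\<bar> powr \<gamma> :: real"
  let ?R = "\<lambda>z. 354 / 1000 * ?B z - (X z - T (?p - 1) 1 z) - (Y z - T 1 (?p - 1) z)"
  have p: "?p < 3" using \<gamma> by simp
  have int: "integrable (M \<Otimes>\<^sub>M M) (T (?p - 1) 1)" "integrable (M \<Otimes>\<^sub>M M) (T 1 (?p - 1))"
    "integrable (M \<Otimes>\<^sub>M M) X" "integrable (M \<Otimes>\<^sub>M M) Y"
    "integrable (M \<Otimes>\<^sub>M M) ?B"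
    using \<gamma> unfolding T_def X_def Y_def
    by (intro integrable_moment_product abs_powr_marginal integrable_sum_powr; simp)+
  have val: "integral\<^sup>L (M \<Otimes>\<^sub>M M) (T (?p - 1) 1) = m (?p - 1) * m 1"
    "integral\<^sup>L (M \<Otimes>\<^sub>M M) (T 1 (?p - 1)) = m 1 * m (?p - 1)"
    "integral\<^sup>L (M \<Otimes>\<^sub>M M) X = m ?p"
    "integral\<^sup>L (M \<Otimes>\<^sub>M M) Y = m ?p"
    using \<gamma> unfolding T_def X_def Y_def
    by (intro integral_moment_product abs_powr_marginal; simp)+
  have mixed: "m (?p - 1) * m 1 \<le> S" "m 1 * m (?p - 1) \<le> S"
    using \<gamma> by (intro mixed_moment_le; simp)+
  have "integral\<^sup>L (M \<Otimes>\<^sub>M M) ?F \<le> integral\<^sup>L (M \<Otimes>\<^sub>M M) ?R"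
  proof (rule integral_mono)
    show "integrable (M \<Otimes>\<^sub>M M) ?F"
    proof (rule integrable_dominated[OF _ p])
      fix x y :: real
      show "\<bar>?F (x, y)\<bar> \<le> 4 * ((1 + \<bar>x\<bar>) * (1 + \<bar>y\<bar>)) powr ?p"
        using collision_integrand_bound[of "\<lambda>t. \<bar>t\<bar> powr (5 / 2)" "5 / 2" \<gamma> x y] \<gamma> by simp
    qed measurable
    show "integrable (M \<Otimes>\<^sub>M M) ?R"
      by (intro Bochner_Integration.integrable_diff integrable_mult_right int)
    fix z :: "real \<times> real"
    obtain x y where z: "z = (x, y)" by fastforce
    have "2 * \<bar>(x + y) / 2\<bar> powr (5 / 2) = 2 powr (- (3 / 2)) * \<bar>x + y\<bar> powr (5 / 2)"
    proof -
      have "2 * \<bar>(x + y) / 2\<bar> powr (5 / 2) = 2 powr 1 / 2 powr (5 / 2) * \<bar>x + y\<bar> powr (5 / 2)"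
        by (simp add: powr_divide)
      then show ?thesis by (simp only: flip: powr_diff) simp
    qed
    also have "\<dots> \<le> 354 / 1000 * (\<bar>x\<bar> + \<bar>y\<bar>) powr (5 / 2)"
      by (intro mult_mono two_powr_minus_three_halves powr_mono2) auto
    finally have c: "2 * \<bar>(x + y) / 2\<bar> powr (5 / 2) \<le> 354 / 1000 * (\<bar>x\<bar> + \<bar>y\<bar>) powr (5 / 2)" .
    have "\<bar>x - y\<bar> powr \<gamma> \<le> (\<bar>x\<bar> + \<bar>y\<bar>) powr \<gamma>"
      using \<gamma> by (intro powr_mono2) auto
    from mult_mono[OF c this]
    have "2 * \<bar>(x + y) / 2\<bar> powr (5 / 2) * \<bar>x - y\<bar> powr \<gamma>
        \<le> 354 / 1000 * (\<bar>x\<bar> + \<bar>y\<bar>) powr (5 / 2) * (\<bar>x\<bar> + \<bar>y\<bar>) powr \<gamma>"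
      by simp
    also have "\<dots> = 354 / 1000 * (\<bar>x\<bar> + \<bar>y\<bar>) powr ?p" by (simp add: powr_add)
    finally have 1: "2 * \<bar>(x + y) / 2\<bar> powr (5 / 2) * \<bar>x - y\<bar> powr \<gamma> \<le> 354 / 1000 * (\<bar>x\<bar> + \<bar>y\<bar>) powr ?p" .
    have 2: "\<bar>x\<bar> powr ?p - \<bar>x\<bar> powr (?p - 1) * \<bar>y\<bar> \<le> \<bar>x\<bar> powr (5 / 2) * \<bar>x - y\<bar> powr \<gamma>"
      using \<gamma> by (intro powr_times_abs_diff_ge) auto
    have "\<bar>y\<bar> powr ?p - \<bar>y\<bar> powr (?p - 1) * \<bar>x\<bar> \<le> \<bar>y\<bar> powr (5 / 2) * \<bar>y - x\<bar> powr \<gamma>"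
      using \<gamma> by (intro powr_times_abs_diff_ge) auto
    then have 3: "\<bar>y\<bar> powr ?p - \<bar>x\<bar> * \<bar>y\<bar> powr (?p - 1) \<le> \<bar>y\<bar> powr (5 / 2) * \<bar>x - y\<bar> powr \<gamma>"
      by (simp add: abs_minus_commute mult.commute)
    have "?F z = 2 * \<bar>(x + y) / 2\<bar> powr (5 / 2) * \<bar>x - y\<bar> powr \<gamma>
      - \<bar>x\<bar> powr (5 / 2) * \<bar>x - y\<bar> powr \<gamma> - \<bar>y\<bar> powr (5 / 2) * \<bar>x - y\<bar> powr \<gamma>"
      unfolding z fst_conv snd_conv by (simp only: left_diff_distrib)
    also have "\<dots> \<le> ?R z"
      unfolding T_def X_def Y_def z fst_conv snd_conv powr_one[OF abs_ge_zero] using 1 2 3 by linarith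
    finally show "?F z \<le> ?R z" .
  qed
  also have "integral\<^sup>L (M \<Otimes>\<^sub>M M) ?R
      = 354 / 1000 * integral\<^sup>L (M \<Otimes>\<^sub>M M) ?B - (m ?p - m (?p - 1) * m 1) - (m ?p - m 1 * m (?p - 1))"
    using int val by (simp del: powr_numeral powr_one)
  also have "\<dots> \<le> 354 / 1000 * (2 * m ?p + 6 * S) - 2 * m ?p + 2 * S"
    using add_mono[OF add_mono[OF mixed] mult_left_mono[OF sum_moment_le[of ?p], of "354 / 1000"]] \<gamma>
    by (simp add: algebra_simps del: powr_numeral powr_one)
  finally have "integral\<^sup>L (M \<Otimes>\<^sub>M M) ?F \<le> 354 / 1000 * (2 * m ?p + 6 * S) - 2 * m ?p + 2 * S" .
  moreover have "- (5 / 2 / 4) * m (5 / 2) = 1 / 2 * integral\<^sup>L (M \<Otimes>\<^sub>M M) ?F"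
    using \<gamma> by (intro weak_form_powr) auto
  ultimately show ?thesis by (simp add: field_simps del: powr_numeral)
qed

text \<open>The two-way comparison of the moments of orders 5/2 and \<open>5 / 2 + \<gamma>\<close>
  bounds them by multiples of \<open>S\<close>, and \<open>2 * m 2 \<le> A (5 / 2)\<close> then
  bounds \<open>m 2\<close> by a multiple of its own power 5/4.\<close>

lemma second_moment_lower: "(1 / 320) ^ 4 \<le> m 2"
proof -
  have closing: "a \<le> 640 * s"
    if "2 * k - 7 * s \<le> 2 * p + 6 * s" "2 * p - 2 * s - 354 / 1000 * (2 * p + 6 * s) \<le> 5 / 4 * k"
      "a \<le> 2 * k + 6 * s" "0 \<le> s" for a k p s :: real
  proof -
    \<comment> \<open>Eliminating \<open>p\<close> leaves \<open>0.042 * k \<le> 12.522 * s\<close>,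
      where 0.042 is \<open>2 * (1 - 354 / 1000) - 5 / 4\<close>. Then \<open>2 * 300 + 6\<close> is
      below 640.\<close>
    have "k \<le> 300 * s" using that by (simp add: field_simps)
    then show ?thesis using that by linarith
  qed
  have "2 * m (5 / 2) - 7 * S \<le> 2 * m (5 / 2 + \<gamma>) + 6 * S"
    using diff_moment_lower diff_moment_mono diff_moment_plus_upper by linarith
  then have "A (5 / 2) \<le> 640 * S"
    by (rule closing[OF _ povzner_estimate diff_moment_upper powr_ge_zero])
  then have "2 * m 2 \<le> 640 * S" using diff_moment_two_le by linarith
  also have "S = m 2 * m 2 powr (1 / 4)"
    using second_moment_pos powr_add[of "m 2" 1 "1 / 4"] by simp
  finally have "m 2 * (1 / 320) \<le> m 2 * m 2 powr (1 / 4)" by simp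
  then have "1 / 320 \<le> m 2 powr (1 / 4)"
    using second_moment_pos by (subst (asm) mult_le_cancel_left_pos) auto
  then have "(1 / 320) ^ 4 \<le> (m 2 powr (1 / 4)) ^ 4" by (intro power_mono) auto
  also have "\<dots> = m 2" using second_moment_pos by (simp add: powr_power)
  finally show ?thesis .
qed

end

subsection \<open>From steady states to steady laws\<close>

text \<open>A function measurable for the completion agrees almost everywhere with a Borel one; its
  maximum with 0 makes nonnegativity hold everywhere, as a density requires.\<close>

lemma borel_representative:
  assumes "G \<in> borel_measurable lebesgue" "AE x in lebesgue. 0 \<le> (G x :: real)"
  obtains g :: "real \<Rightarrow> real"
  where "g \<in> borel_measurable borel" "\<And>x. 0 \<le> g x" "AE x in lborel. G x = g x"
proof -
  obtain f where f: "f \<in> borel_measurable lborel" "AE x in lborel. G x = f x"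
    using completion_ex_borel_measurable_real[OF assms(1)] by auto
  have "AE x in lborel. 0 \<le> G x"
    using assms(2) by (simp add: AE_completion_iff)
  with f(2) have "AE x in lborel. G x = max 0 (f x)"
    by eventually_elim simp
  moreover have "(\<lambda>x. max 0 (f x)) \<in> borel_measurable borel"
    using f(1) by simp
  ultimately show thesis
    by (intro that[of "\<lambda>x. max 0 (f x)"]) simp_all
qed

text \<open>Completeness of Lebesgue measure: preimages under the two functions differ by a null
  set.\<close>

lemma measurable_lebesgue_cong_AE:
  fixes f h :: "'a::euclidean_space \<Rightarrow> real"
  assumes f: "f \<in> borel_measurable lebesgue" and eq: "AE x in lebesgue. h x = f x"
  shows "h \<in> borel_measurable lebesgue"
proof (rule measurableI)
  fix B :: "real set" assume "B \<in> sets borel"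
  with f have "f -` B \<inter> space lebesgue \<in> sets lebesgue" by (rule measurable_sets)
  moreover have "AE x in lebesgue. x \<in> f -` B \<inter> space lebesgue \<longleftrightarrow> x \<in> h -` B \<inter> space lebesgue"
    using eq by eventually_elim simp
  ultimately show "h -` B \<inter> space lebesgue \<in> sets lebesgue"
    using completion.in_sets_AE by (metis inf_le2)
qed simp

text \<open>If \<open>N\<close> is null on the line, almost every point of the plane has both
  coordinates outside \<open>N\<close>, by Fubini.\<close>

lemma AE_lborel_prod:
  assumes "AE x in (lborel :: real measure). P x"
  shows "AE z in (lborel :: (real \<times> real) measure). P (fst z) \<and> P (snd z)"
proof -
  obtain N where N: "\<And>x. x \<in> space lborel - N \<Longrightarrow> P x" "N \<in> null_sets lborel"
    using AE_E3[OF assms] by blast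
  have [measurable]: "N \<in> sets borel" using N(2) by (simp add: null_sets_def)
  have ae: "AE x in lborel. x \<notin> N" using N(2) by (rule AE_not_in)
  have "AE z in lborel \<Otimes>\<^sub>M lborel. fst z \<notin> N \<and> snd z \<notin> N"
  proof (rule lborel_pair.AE_pair_measure)
    show "AE x in lborel. AE y in lborel. fst (x, y) \<notin> N \<and> snd (x, y) \<notin> N"
      using ae
    proof eventually_elim
      case (elim x)
      show ?case using ae by eventually_elim (simp add: elim)
    qed
  qed measurable
  then show ?thesis
    unfolding lborel_prod by eventually_elim (simp add: N(1))
qed

text \<open>The law has a Borel version \<open>g\<close> of \<open>G\<close> as density. The work
  lies in moving integrals from the completed measures on the line and the plane to this law and its
  square.\<close>

lemma steady_state_law:
  assumes \<gamma>: "0 < \<gamma>" "\<gamma> < 1 / 2" and G: "G \<in> steady_states \<gamma>"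
  obtains M where "steady_law M \<gamma>" "moment 2 G = (\<integral>x. \<bar>x\<bar> powr 2 \<partial>M)"
proof -
  have weights: "G \<in> L1_weighted s" if "s < 3" for s
    using G that unfolding steady_states_def by blast
  have nonneg: "AE x in lebesgue. 0 \<le> G x"
    and mass: "(\<integral>x. G x \<partial>lebesgue) = 1"
    and mean: "(\<integral>x. x * G x \<partial>lebesgue) = 0"
    and weak: "\<And>\<phi>. \<phi> \<in> C1_bounded \<Longrightarrow>
            - (1 / 4) * (\<integral>x. x * deriv \<phi> x * G x \<partial>lebesgue) = collision_weak \<gamma> G G \<phi>"
    using G unfolding steady_states_def by blast+
  have Gm [measurable]: "G \<in> borel_measurable lebesgue"
    using weights[of 0] by (simp add: L1_weighted_def)
  from Gm obtain g where g [measurable]: "g \<in> borel_measurable borel"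
    and g0: "\<And>x. 0 \<le> g x" and ae: "AE x in lborel. G x = g x"
    using nonneg borel_representative by blast
  define M where "M = density lborel (\<lambda>x. ennreal (g x))"
  have [measurable_cong]: "sets M = sets borel" by (simp add: M_def)
  have transfer: "(\<integral>x. h x * G x \<partial>lebesgue) = (\<integral>x. h x \<partial>M)"
    if [measurable]: "h \<in> borel_measurable borel" for h :: "real \<Rightarrow> real"
  proof -
    have "(\<integral>x. h x * G x \<partial>lebesgue) = (\<integral>x. g x * h x \<partial>lebesgue)"
    proof (rule integral_cong_AE)
      show "AE x in lebesgue. h x * G x = g x * h x"
        using AE_completion[OF ae] by eventually_elim simp
      have "h \<in> borel_measurable lebesgue" "g \<in> borel_measurable lebesgue"
        by (simp_all add: measurable_completion)
      then show "(\<lambda>x. h x * G x) \<in> borel_measurable lebesgue" "(\<lambda>x. g x * h x) \<in> borel_measurable lebesgue"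
        using Gm by simp_all
    qed
    also have "\<dots> = (\<integral>x. g x * h x \<partial>lborel)" by (rule integral_completion) measurable
    also have "\<dots> = (\<integral>x. h x \<partial>M)" unfolding M_def using g0 by (subst integral_density) auto
    finally show ?thesis .
  qed
  have MM: "M \<Otimes>\<^sub>M M = density lborel (\<lambda>z. ennreal (g (fst z) * g (snd z)))" if "sigma_finite_measure M"
  proof -
    have "M \<Otimes>\<^sub>M M = density (lborel \<Otimes>\<^sub>M lborel) (\<lambda>(x, y). ennreal (g x) * ennreal (g y))"
      unfolding M_def
      by (rule pair_measure_density) (use that in \<open>auto simp: M_def lborel.sigma_finite_measure_axioms\<close>)
    then show ?thesis
      using g0 by (simp add: lborel_prod case_prod_beta' ennreal_mult)
  qed
  \<comment> \<open>In the application \<open>h\<close> is the collision bracket and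
    \<open>k\<close> the kernel \<open>|x - y| powr \<gamma>\<close>. Measurability of the integrand
    with \<open>G\<close> is inherited from the Borel version by equality almost everywhere.\<close>
  have transfer2: "(\<integral>(x, y). G x * G y * h x y * k x y \<partial>lebesgue) = (\<integral>z. h (fst z) (snd z) * k (fst z) (snd z) \<partial>(M \<Otimes>\<^sub>M M))"
    if [measurable]: "(\<lambda>z. h (fst z) (snd z)) \<in> borel_measurable borel" "(\<lambda>z. k (fst z) (snd z)) \<in> borel_measurable borel"
      and "sigma_finite_measure M" for h k :: "real \<Rightarrow> real \<Rightarrow> real"
  proof -
    let ?g = "\<lambda>z. g (fst z) * g (snd z) * (h (fst z) (snd z) * k (fst z) (snd z)) :: real"
    have [measurable]: "(\<lambda>z. g (fst z)) \<in> borel_measurable (borel :: (real \<times> real) measure)"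
      "(\<lambda>z. g (snd z)) \<in> borel_measurable (borel :: (real \<times> real) measure)"
      unfolding borel_prod[symmetric] by measurable
    have gm: "?g \<in> borel_measurable lborel"
      by simp
    have eq: "AE z in lebesgue. (case z of (x, y) \<Rightarrow> G x * G y * h x y * k x y) = ?g z"
      using AE_completion[OF AE_lborel_prod[OF ae]]
      by eventually_elim (simp add: case_prod_beta' mult.assoc)
    have "(\<integral>(x, y). G x * G y * h x y * k x y \<partial>lebesgue) = (\<integral>z. ?g z \<partial>lebesgue)"
    proof (rule integral_cong_AE[OF _ _ eq])
      show "?g \<in> borel_measurable lebesgue" using gm by (rule measurable_completion)
      then show "(\<lambda>z. case z of (x, y) \<Rightarrow> G x * G y * h x y * k x y) \<in> borel_measurable lebesgue"
        using eq by (rule measurable_lebesgue_cong_AE)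
    qed
    also have "\<dots> = (\<integral>z. ?g z \<partial>lborel)" by (rule integral_completion[OF gm])
    also have "\<dots> = (\<integral>z. h (fst z) (snd z) * k (fst z) (snd z) \<partial>(M \<Otimes>\<^sub>M M))"
      unfolding MM[OF that(3)] using g0 by (subst integral_density) auto
    finally show ?thesis .
  qed
  have int_weight: "integrable M (\<lambda>x. (1 + \<bar>x\<bar>) powr s)" if "s < 3" for s
  proof -
    have "integrable lebesgue (\<lambda>x. \<bar>G x\<bar> * weight s x)"
      using weights[OF that] by (simp add: L1_weighted_def)
    then have "integrable lebesgue (\<lambda>x. g x * (1 + \<bar>x\<bar>) powr s)"
    proof (rule integrable_cong_AE_imp)
      show "AE x in lebesgue. \<bar>G x\<bar> * weight s x = g x * (1 + \<bar>x\<bar>) powr s"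
        using AE_completion[OF ae] by eventually_elim (use g0 in \<open>simp add: weight_def\<close>)
    qed (intro measurable_completion, measurable)
    then have "integrable lborel (\<lambda>x. g x * (1 + \<bar>x\<bar>) powr s)"
      by (subst (asm) integrable_completion) auto
    then show ?thesis
      unfolding M_def using g0 by (subst integrable_density) auto
  qed
  \<comment> \<open>The weight of order 0 is the constant 1, its base being positive. This yields
    integrability of \<open>g\<close>, so the Bochner mass 1 is also the nonnegative integral needed
    for a probability measure.\<close>
  have "integrable M (\<lambda>x. (1 + \<bar>x\<bar>) powr 0)" by (rule int_weight) simp
  moreover have "(\<lambda>x::real. (1 + \<bar>x\<bar>) powr 0) = (\<lambda>x. 1)"
    by (auto simp: fun_eq_iff add_nonneg_eq_0_iff)
  ultimately have "integrable M (\<lambda>x. 1 :: real)" by simp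
  then have "integrable lborel g"
    unfolding M_def using g0 by (subst (asm) integrable_density) auto
  moreover have "(\<integral>x. g x \<partial>lborel) = 1"
  proof -
    have "(\<integral>x. 1 \<partial>M) = (1 :: real)" using transfer[of "\<lambda>_. 1"] mass by simp
    then show ?thesis
      unfolding M_def using g0 by (subst (asm) integral_density) auto
  qed
  ultimately have "(\<integral>\<^sup>+x. ennreal (g x) \<partial>lborel) = 1"
    using g0 by (subst nn_integral_eq_integral) auto
  then have prob: "prob_space M"
    unfolding M_def by (intro prob_spaceI) (simp add: emeasure_density)
  then interpret prob_space M .
  note sf = sigma_finite_measure_axioms
  have "steady_law M \<gamma>"
  proof
    show "sets M = sets borel" by fact
    show "integrable M (\<lambda>x. (1 + \<bar>x\<bar>) powr s)" if "s < 3" for s by (rule int_weight[OF that])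
    show "(\<integral>x. x \<partial>M) = 0" using transfer[of "\<lambda>x. x"] mean by simp
    show "emeasure M {0} = 0"
      unfolding M_def by (simp add: emeasure_density nn_integral_cmult_indicator)
    show "0 < \<gamma>" "\<gamma> < 1 / 2" by (rule \<gamma>)+
    fix \<phi> assume \<phi>: "\<phi> \<in> C1_bounded"
    then have [measurable]: "deriv \<phi> \<in> borel_measurable borel"
      unfolding C1_bounded_def by (auto intro: borel_measurable_continuous_onI)
    have [measurable]: "\<phi> \<in> borel_measurable borel"
      using \<phi> unfolding C1_bounded_def
      by (auto intro!: borel_measurable_continuous_onI continuous_at_imp_continuous_on
          differentiable_imp_continuous_within)
    have "(\<integral>x. x * deriv \<phi> x \<partial>M) = (\<integral>x. x * deriv \<phi> x * G x \<partial>lebesgue)"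
      by (rule transfer[symmetric]) measurable
    also have "- (1 / 4) * \<dots> = collision_weak \<gamma> G G \<phi>" by (rule weak[OF \<phi>])
    also have "\<dots> = 1 / 2 * (\<integral>z. (2 * \<phi> ((fst z + snd z) / 2) - \<phi> (fst z) - \<phi> (snd z))
        * \<bar>fst z - snd z\<bar> powr \<gamma> \<partial>(M \<Otimes>\<^sub>M M))"
    proof -
      have "(\<lambda>z. 2 * \<phi> ((fst z + snd z) / 2) - \<phi> (fst z) - \<phi> (snd z)) \<in> borel_measurable borel"
        "(\<lambda>z. \<bar>fst z - snd z\<bar> powr \<gamma>) \<in> borel_measurable borel"
        unfolding borel_prod[symmetric] by measurable
      from transfer2[OF this sf] show ?thesis
        unfolding collision_weak_def by simp
    qed
    finally show "- (1 / 4) * (\<integral>x. x * deriv \<phi> x \<partial>M) =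
        1 / 2 * (\<integral>z. (2 * \<phi> ((fst z + snd z) / 2) - \<phi> (fst z) - \<phi> (snd z)) * \<bar>fst z - snd z\<bar> powr \<gamma>
          \<partial>(M \<Otimes>\<^sub>M M))" .
  qed
  moreover have "moment 2 G = (\<integral>x. \<bar>x\<bar> powr 2 \<partial>M)"
    unfolding moment_def by (subst transfer[symmetric]) (auto simp: mult.commute)
  ultimately show thesis by (rule that)
qed

theorem proposition1p3:
  fixes k\<^sub>0 :: real
  assumes "0 < k\<^sub>0" and "k\<^sub>0 < 1 / 2"
  shows "\<exists>\<alpha>\<^sub>2::real. \<alpha>\<^sub>2 > 0 \<and>
    (\<forall>\<gamma>\<in>{0<..<k\<^sub>0}. \<forall>G\<in>steady_states \<gamma>. \<alpha>\<^sub>2 \<le> moment 2 G \<and> moment 2 G \<le> 1 / 2)"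
proof (intro exI[of _ "(1 / 320) ^ 4"] conjI ballI)
  fix \<gamma> G assume "\<gamma> \<in> {0<..<k\<^sub>0}" "G \<in> steady_states \<gamma>"
  \<comment> \<open>The assumption on \<open>k\<^sub>0\<close> places \<open>\<gamma>\<close> below
    1/2, and the witness \<open>(1 / 320) ^ 4\<close> does not involve \<open>\<gamma>\<close>,
    which gives uniformity.\<close>
  then obtain M where M: "steady_law M \<gamma>" "moment 2 G = (\<integral>x. \<bar>x\<bar> powr 2 \<partial>M)"
    using assms by (auto elim!: steady_state_law[rotated 2])
  show "(1 / 320) ^ 4 \<le> moment 2 G"
    unfolding M(2) by (rule steady_law.second_moment_lower[OF M(1)])
  show "moment 2 G \<le> 1 / 2"
    unfolding M(2) by (rule steady_law.second_moment_le_half[OF M(1)])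
qed simp

end
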